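(* Suppose no arm is support-degenerate. Let $S$ be the set of arms $i$ such that $\Pr[\mu_j<\mathbb E[\mu_i]]>0$ for all arms $j\neq i$. (a) If there is a BIC algorithm which recommends arm $i$ with positive probability in some round, then $i\in S$. (b) If a bandit algorithm is BIC for every problem instance satisfying pairwise non-dominance, then the algorithm run on the instance restricted to the arms in $S$ (with their priors) is BIC in the original instance. (c) There is a BIC algorithm and a finite time $t^*$ depending on the prior such that every arm in $S$ is chosen at least once within $t^*$ rounds with probability $1$.
   Context: Incentivized exploration model: $K$ arms; mean rewards $\mu_1,\dots,\mu_K\in[0,1]$ drawn independently, $\mu_i\sim\mathcal P_i$ with known priors; Bernoulli rewards (each arm has an i.i.d. $\{0,1\}$ sample sequence with mean $\mu_i$, revealed one per choice). Each round the algorithm recommends $A_t$, the agent chooses $A'_t$, and the reward is observed by the algorithm only. With $\mathcal E_{t-1}=\{A'_s=A_s\ \forall s<t\}$, the algorithm is BIC if $\mathbb E[\mu_i-\mu_j\mid A_t=i,\mathcal E_{t-1}]\geq0$ for all rounds $t$ and arms $i,j$ with $\Pr[A_t=i]>0$. An arm $i$ is support-degenerate if there is $x\in[0,1)$ with $\Pr[\mu_i\in\{x,1\}]=1$. Pairwise non-dominance: $\Pr[\mu_j<\mathbb E[\mu_i]]>0$ for all arms $i\neq j$ (not assumed here). *)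

theory Defs
  imports "HOL-Probability.Probability"
begin

text \<open>Arms are natural numbers; an instance is a finite nonempty arm set A together with
  priors P i (a probability measure on the reals, concentrated on [0,1]) for i in A.
  The mean-reward vector mu is drawn from the independent product of the priors.\<close>

definition valid_instance :: "nat set \<Rightarrow> (nat \<Rightarrow> real measure) \<Rightarrow> bool" where
  "valid_instance A P \<longleftrightarrow> finite A \<and> A \<noteq> {} \<and>
     (\<forall>i\<in>A. prob_space (P i) \<and> sets (P i) = sets borel \<and> measure (P i) {0..1} = 1)"

definition prior_mean :: "(nat \<Rightarrow> real measure) \<Rightarrow> nat \<Rightarrow> real" where
  "prior_mean P i = (\<integral>x. x \<partial>P i)"

definition support_degenerate :: "(nat \<Rightarrow> real measure) \<Rightarrow> nat \<Rightarrow> bool" where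
  "support_degenerate P i \<longleftrightarrow> (\<exists>x. 0 \<le> x \<and> x < 1 \<and> measure (P i) {x, 1} = 1)"

definition not_dominated :: "(nat \<Rightarrow> real measure) \<Rightarrow> nat \<Rightarrow> nat \<Rightarrow> bool" where
  "not_dominated P i j \<longleftrightarrow> measure (P j) {x. x < prior_mean P i} > 0"

definition pairwise_nondominance :: "nat set \<Rightarrow> (nat \<Rightarrow> real measure) \<Rightarrow> bool" where
  "pairwise_nondominance A P \<longleftrightarrow> (\<forall>i\<in>A. \<forall>j\<in>A. i \<noteq> j \<longrightarrow> not_dominated P i j)"

definition S_arms :: "nat set \<Rightarrow> (nat \<Rightarrow> real measure) \<Rightarrow> nat set" where
  "S_arms A P = {i\<in>A. \<forall>j\<in>A. j \<noteq> i \<longrightarrow> not_dominated P i j}"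

text \<open>A (randomized) algorithm for a fixed instance: given the history of
  (recommended arm, observed reward) pairs of the previous rounds, a distribution over
  the arm to recommend next (behavioural representation of a randomized algorithm).
  It is an algorithm for arm set A if it only recommends arms in A.\<close>
type_synonym policy = "(nat \<times> bool) list \<Rightarrow> nat pmf"

definition is_algorithm :: "nat set \<Rightarrow> policy \<Rightarrow> bool" where
  "is_algorithm A \<pi> \<longleftrightarrow> (\<forall>h. set_pmf (\<pi> h) \<subseteq> A)"

text \<open>Distribution of the history of the first t rounds, given the mean vector mu,
  on the event that agents follow all recommendations: each choice of arm a reveals the
  next i.i.d. Bernoulli(mu a) sample of that arm.\<close>
primrec hist :: "policy \<Rightarrow> (nat \<Rightarrow> real) \<Rightarrow> nat \<Rightarrow> (nat \<times> bool) list pmf" where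
  "hist \<pi> \<mu> 0 = return_pmf []"
| "hist \<pi> \<mu> (Suc t) = bind_pmf (hist \<pi> \<mu> t)
     (\<lambda>h. bind_pmf (\<pi> h) (\<lambda>a. map_pmf (\<lambda>r. h @ [(a, r)]) (bernoulli_pmf (\<mu> a))))"

text \<open>Distribution (given mu) of the recommendation in round t+1 (rounds counted from 1).\<close>
definition recommendation :: "policy \<Rightarrow> (nat \<Rightarrow> real) \<Rightarrow> nat \<Rightarrow> nat pmf" where
  "recommendation \<pi> \<mu> t = bind_pmf (hist \<pi> \<mu> t) \<pi>"

definition prior :: "nat set \<Rightarrow> (nat \<Rightarrow> real measure) \<Rightarrow> (nat \<Rightarrow> real) measure" where
  "prior A P = (\<Pi>\<^sub>M i\<in>A. P i)"

definition prob_rec :: "nat set \<Rightarrow> (nat \<Rightarrow> real measure) \<Rightarrow> policy \<Rightarrow> nat \<Rightarrow> nat \<Rightarrow> real" where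
  "prob_rec A P \<pi> t i = (\<integral>\<mu>. pmf (recommendation \<pi> \<mu> t) i \<partial>prior A P)"

definition gap_rec :: "nat set \<Rightarrow> (nat \<Rightarrow> real measure) \<Rightarrow> policy \<Rightarrow> nat \<Rightarrow> nat \<Rightarrow> nat \<Rightarrow> real" where
  "gap_rec A P \<pi> t i j = (\<integral>\<mu>. (\<mu> i - \<mu> j) * pmf (recommendation \<pi> \<mu> t) i \<partial>prior A P)"

text \<open>BIC: E[mu_i - mu_j | A_t = i, E_{t-1}] >= 0 whenever Pr[A_t = i] > 0
  (conditional expectation given an event of positive probability, written as a ratio).\<close>
definition BIC :: "nat set \<Rightarrow> (nat \<Rightarrow> real measure) \<Rightarrow> policy \<Rightarrow> bool" where
  "BIC A P \<pi> \<longleftrightarrow> (\<forall>t. \<forall>i\<in>A. \<forall>j\<in>A. prob_rec A P \<pi> t i > 0 \<longrightarrow>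
       gap_rec A P \<pi> t i j / prob_rec A P \<pi> t i \<ge> 0)"

definition prob_chosen_within :: "nat set \<Rightarrow> (nat \<Rightarrow> real measure) \<Rightarrow> policy \<Rightarrow> nat \<Rightarrow> nat \<Rightarrow> real" where
  "prob_chosen_within A P \<pi> T i =
     (\<integral>\<mu>. measure_pmf.prob (hist \<pi> \<mu> T) {h. i \<in> fst ` set h} \<partial>prior A P)"

end

theory Submission
  imports Defs
begin

text \<open>Write \<open>V i h\<close> for the prior expectation of \<open>\<mu> i\<close> times the likelihood of the rewards in the history \<open>h\<close>.
  Every BIC constraint is a finite sum over histories of policy probabilities times \<open>V i h - V j h\<close>.

  (a) At the first round in which \<open>i\<close> can be recommended, \<open>i\<close> is unsampled. If \<open>j\<close> dominates \<open>i\<close>, each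
  summand is nonpositive, and it is negative on reachable histories because \<open>j\<close> is not
  support-degenerate.

  (b) A dominated arm is dominated by an arm in \<open>S\<close>, whose BIC constraint implies its own.

  (c) Arms are explored one at a time in the order of decreasing prior mean. Fix the time \<open>T\<close> at which all
  arms of \<open>E\<close> have been sampled often, and let \<open>j\<close> be the next arm. Mixing the posterior-optimal arm at
  time \<open>T\<close> (weight \<open>1 - 1 / L\<close>) with \<open>j\<close> (weight \<open>1 / L\<close>) is BIC for large \<open>L\<close>: on an all-zero history
  every arm in \<open>E\<close> looks strictly worse than \<open>j\<close>, which gives a fixed gain. Repeating this for \<open>L\<close> rounds,
  with exactly one exploration of \<open>j\<close> hidden among them, surely samples \<open>j\<close>; repeat for more samples.\<close>

subsection \<open>Histories\<close>

definition histories :: "nat set \<Rightarrow> nat \<Rightarrow> (nat \<times> bool) list set" where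
  "histories B t = {h. set h \<subseteq> B \<times> UNIV \<and> length h = t}"

text \<open>The factor of a history's likelihood that is due to the algorithm. It does not depend on
  the mean vector, so it leaves every integral over the prior, and it is nonzero exactly when the
  recommendations in \<open>h\<close> are possible.\<close>

definition policy_weight :: "policy \<Rightarrow> (nat \<times> bool) list \<Rightarrow> real" where
  "policy_weight \<pi> h = (\<Prod>n<length h. pmf (\<pi> (take n h)) (fst (h ! n)))"

definition reward_weight :: "(nat \<Rightarrow> real) \<Rightarrow> (nat \<times> bool) list \<Rightarrow> real" where
  "reward_weight \<mu> h = (\<Prod>(a, r)\<leftarrow>h. pmf (bernoulli_pmf (\<mu> a)) r)"

text \<open>The factor contributed by the samples of arm \<open>a\<close>, as a function of that
  arm's mean alone. It lets the reward likelihood be written as a product over independent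
  coordinates.\<close>

definition arm_likelihood :: "(nat \<times> bool) list \<Rightarrow> nat \<Rightarrow> real \<Rightarrow> real" where
  "arm_likelihood h a x = (\<Prod>(b, r)\<leftarrow>h. if b = a then pmf (bernoulli_pmf x) r else 1)"

lemma finite_histories: "finite B \<Longrightarrow> finite (histories B t)"
  unfolding histories_def by (intro finite_lists_length_eq) auto

lemma histories_0 [simp]: "histories B 0 = {[]}"
  by (auto simp: histories_def)

lemma length_histories: "h \<in> histories B t \<Longrightarrow> length h = t"
  by (simp add: histories_def)

lemma histories_Suc:
  "histories B (Suc t) = (\<lambda>(h, a, r). h @ [(a, r)]) ` (histories B t \<times> B \<times> UNIV)"
proof (intro equalityI subsetI)
  fix h assume h: "h \<in> histories B (Suc t)"
  then obtain g a r where "h = g @ [(a, r)]"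
    by (cases h rule: rev_cases) (auto simp: histories_def)
  with h show "h \<in> (\<lambda>(h, a, r). h @ [(a, r)]) ` (histories B t \<times> B \<times> UNIV)"
    by (intro image_eqI[of _ _ "(g, a, r)"]) (auto simp: histories_def)
qed (auto simp: histories_def)

lemma sum_histories_Suc:
  fixes f :: "(nat \<times> bool) list \<Rightarrow> real"
  shows "(\<Sum>h\<in>histories B (Suc t). f h) =
    (\<Sum>h\<in>histories B t. \<Sum>a\<in>B. f (h @ [(a, True)]) + f (h @ [(a, False)]))"
proof -
  have "inj_on (\<lambda>(h, a, r). h @ [(a, r)]) (histories B t \<times> B \<times> (UNIV :: bool set))"
    by (auto simp: inj_on_def)
  then show ?thesis
    by (simp add: histories_Suc sum.reindex sum.cartesian_product' split_def UNIV_bool add.commute)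
qed

lemma policy_weight_Nil [simp]: "policy_weight \<pi> [] = 1"
  by (simp add: policy_weight_def)

lemma policy_weight_snoc [simp]:
  "policy_weight \<pi> (h @ [(a, r)]) = policy_weight \<pi> h * pmf (\<pi> h) a"
proof -
  have "(\<Prod>n<length h. pmf (\<pi> (take n (h @ [(a, r)]))) (fst ((h @ [(a, r)]) ! n))) =
    policy_weight \<pi> h"
    unfolding policy_weight_def by (intro prod.cong) (auto simp: nth_append)
  then show ?thesis
    unfolding policy_weight_def by simp
qed

lemma policy_weight_nonneg: "0 \<le> policy_weight \<pi> h"
  by (simp add: policy_weight_def prod_nonneg)

lemma policy_weight_cong:
  assumes "\<And>g. length g < length h \<Longrightarrow> \<pi> g = \<pi>' g"
  shows "policy_weight \<pi> h = policy_weight \<pi>' h"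
  unfolding policy_weight_def by (intro prod.cong) (auto simp: assms)

lemma policy_weight_take_nonzero:
  assumes "policy_weight \<pi> h \<noteq> 0"
  shows "policy_weight \<pi> (take n h) \<noteq> 0"
  using assms by (auto simp: policy_weight_def min_def)

lemma policy_weight_nth_nonzero:
  assumes "policy_weight \<pi> h \<noteq> 0" "n < length h"
  shows "pmf (\<pi> (take n h)) (fst (h ! n)) \<noteq> 0"
  using assms by (auto simp: policy_weight_def)

lemma policy_weight_nonzero_arms:
  assumes "is_algorithm B \<pi>" "policy_weight \<pi> h \<noteq> 0"
  shows "h \<in> histories B (length h)"
proof -
  have "fst (h ! n) \<in> B" if "n < length h" for n
    using policy_weight_nth_nonzero[OF assms(2) that] assms(1)
    by (auto simp: is_algorithm_def set_pmf_iff[symmetric])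
  then have "fst x \<in> B" if "x \<in> set h" for x
    using that by (auto simp: in_set_conv_nth)
  then show ?thesis
    by (auto simp: histories_def)
qed

section \<open>Factorisation of the law of histories and recommendations\<close>

lemma pmf_bind_unique:
  assumes "\<And>x. x \<noteq> x0 \<Longrightarrow> pmf (f x) y = 0"
  shows "pmf (bind_pmf M f) y = pmf M x0 * pmf (f x0) y"
proof -
  have "pmf (bind_pmf M f) y = (\<integral>x. pmf (f x) y \<partial>M)"
    by (simp add: pmf_bind)
  also have "\<dots> = (\<Sum>x\<in>{x0}. pmf (f x) y * pmf M x)"
    by (rule integral_measure_pmf_real) (use assms in auto)
  finally show ?thesis
    by simp
qed

lemma pmf_hist_snoc:
  "pmf (hist \<pi> \<mu> (Suc t)) (h @ [(a, r)]) =
    pmf (hist \<pi> \<mu> t) h * (pmf (\<pi> h) a * pmf (bernoulli_pmf (\<mu> a)) r)"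
proof -
  have inj: "inj (\<lambda>r. h @ [(a, r)])" for a and h :: "(nat \<times> bool) list"
    by (auto simp: inj_def)
  have out: "pmf (map_pmf (\<lambda>r. g @ [(b, r)]) (bernoulli_pmf x)) (h @ [(a, r)]) = 0"
    if "g \<noteq> h \<or> b \<noteq> a" for g b x
    using that by (subst pmf_map_outside) auto
  have "pmf (bind_pmf (\<pi> g) (\<lambda>a. map_pmf (\<lambda>r. g @ [(a, r)]) (bernoulli_pmf (\<mu> a))))
      (h @ [(a, r)]) = 0" if "g \<noteq> h" for g
    using that by (simp add: pmf_bind out)
  then have "pmf (hist \<pi> \<mu> (Suc t)) (h @ [(a, r)]) = pmf (hist \<pi> \<mu> t) h *
      pmf (bind_pmf (\<pi> h) (\<lambda>a. map_pmf (\<lambda>r. h @ [(a, r)]) (bernoulli_pmf (\<mu> a)))) (h @ [(a, r)])"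
    by (simp add: pmf_bind_unique[where ?x0.0 = h])
  also have "pmf (bind_pmf (\<pi> h) (\<lambda>a. map_pmf (\<lambda>r. h @ [(a, r)]) (bernoulli_pmf (\<mu> a))))
      (h @ [(a, r)]) = pmf (\<pi> h) a * pmf (bernoulli_pmf (\<mu> a)) r"
    by (subst pmf_bind_unique[where ?x0.0 = a]) (simp_all add: out pmf_map_inj'[OF inj])
  finally show ?thesis .
qed

lemma pmf_hist: "pmf (hist \<pi> \<mu> (length h)) h = policy_weight \<pi> h * reward_weight \<mu> h"
proof (induction h rule: rev_induct)
  case (snoc x h)
  then show ?case
    by (cases x) (simp add: pmf_hist_snoc reward_weight_def del: hist.simps)
qed (simp add: reward_weight_def)

lemma length_hist: "h \<in> set_pmf (hist \<pi> \<mu> t) \<Longrightarrow> length h = t"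
  by (induction t arbitrary: h) auto

lemma set_hist:
  assumes "h \<in> set_pmf (hist \<pi> \<mu> t)"
  shows "length h = t" "policy_weight \<pi> h \<noteq> 0"
  using pmf_hist[of \<pi> \<mu> h] assms length_hist[OF assms] by (auto simp: set_pmf_iff)

text \<open>Histories of positive probability use only arms of \<open>B\<close>, so the expectation
  over histories is a finite sum. All dependence on \<open>\<mu>\<close> is confined to
  \<open>reward_weight\<close>.\<close>

lemma pmf_recommendation:
  assumes "is_algorithm B \<pi>" "finite B"
  shows "pmf (recommendation \<pi> \<mu> t) i =
    (\<Sum>h\<in>histories B t. policy_weight \<pi> h * pmf (\<pi> h) i * reward_weight \<mu> h)"
proof -
  have "pmf (recommendation \<pi> \<mu> t) i = (\<integral>h. pmf (\<pi> h) i \<partial>hist \<pi> \<mu> t)"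
    by (simp add: recommendation_def pmf_bind)
  also have "\<dots> = (\<Sum>h\<in>histories B t. pmf (\<pi> h) i * pmf (hist \<pi> \<mu> t) h)"
    using assms set_hist policy_weight_nonzero_arms
    by (intro integral_measure_pmf_real finite_histories) metis+
  also have "\<dots> = (\<Sum>h\<in>histories B t. policy_weight \<pi> h * pmf (\<pi> h) i * reward_weight \<mu> h)"
  proof (intro sum.cong refl)
    fix h assume "h \<in> histories B t"
    then show "pmf (\<pi> h) i * pmf (hist \<pi> \<mu> t) h =
        policy_weight \<pi> h * pmf (\<pi> h) i * reward_weight \<mu> h"
      using pmf_hist[of \<pi> \<mu> h] by (simp add: length_histories)
  qed
  finally show ?thesis .
qed

text \<open>Grouping the rewards by arm turns the product over rounds into one over arms, the form
  to which independence of the priors applies.\<close>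

lemma reward_weight_eq_prod:
  assumes "finite A" "h \<in> histories A t"
  shows "reward_weight \<mu> h = (\<Prod>a\<in>A. arm_likelihood h a (\<mu> a))"
proof -
  have "set h \<subseteq> A \<times> UNIV"
    using assms(2) by (simp add: histories_def)
  then show ?thesis
  proof (induction h)
    case (Cons x h)
    obtain a r where x: "x = (a, r)"
      by (cases x)
    have "(\<Prod>b\<in>A. arm_likelihood (x # h) b (\<mu> b)) =
        (\<Prod>b\<in>A. if a = b then pmf (bernoulli_pmf (\<mu> b)) r else 1) * (\<Prod>b\<in>A. arm_likelihood h b (\<mu> b))"
      by (simp add: arm_likelihood_def x prod.distrib)
    also have "(\<Prod>b\<in>A. if a = b then pmf (bernoulli_pmf (\<mu> b)) r else 1) = pmf (bernoulli_pmf (\<mu> a)) r"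
      using Cons.prems assms(1) x by (simp add: prod.delta)
    finally show ?case
      using Cons by (simp add: reward_weight_def x)
  qed (simp add: reward_weight_def arm_likelihood_def)
qed

section \<open>The likelihood of a single arm\<close>

lemma pmf_bernoulli_clamp:
  "pmf (bernoulli_pmf x) r = (if r then min 1 (max 0 x) else 1 - min 1 (max 0 x))"
  by (simp add: bernoulli_pmf.rep_eq)

lemma arm_likelihood_Nil [simp]: "arm_likelihood [] a x = 1"
  by (simp add: arm_likelihood_def)

lemma arm_likelihood_snoc:
  "arm_likelihood (h @ [(b, r)]) a x =
    arm_likelihood h a x * (if b = a then pmf (bernoulli_pmf x) r else 1)"
  by (simp add: arm_likelihood_def)

text \<open>\<open>bernoulli_pmf\<close> clamps its parameter to the unit interval, so the
  likelihood is a product of continuous functions on all of the reals.\<close>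

lemma measurable_arm_likelihood [measurable]: "arm_likelihood h a \<in> borel_measurable borel"
proof (induction h rule: rev_induct)
  case (snoc y h)
  then show ?case
    by (cases y; cases "snd y"; cases "fst y = a") (simp_all add: arm_likelihood_snoc pmf_bernoulli_clamp)
qed simp

lemma arm_likelihood_nonneg: "0 \<le> arm_likelihood h a x"
  by (induction h rule: rev_induct) (auto simp: arm_likelihood_snoc)

lemma arm_likelihood_le_1: "arm_likelihood h a x \<le> 1"
proof (induction h rule: rev_induct)
  case (snoc y h)
  then show ?case
    by (cases y) (auto simp: arm_likelihood_snoc arm_likelihood_nonneg pmf_le_1 intro: mult_le_one)
qed simp

lemma arm_likelihood_pos: "0 < x \<Longrightarrow> x < 1 \<Longrightarrow> 0 < arm_likelihood h a x"
  by (induction h rule: rev_induct) (auto simp: arm_likelihood_snoc pmf_bernoulli_clamp)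

lemma arm_likelihood_unsampled: "a \<notin> fst ` set h \<Longrightarrow> arm_likelihood h a x = 1"
  by (induction h rule: rev_induct) (auto simp: arm_likelihood_snoc)

lemma arm_likelihood_zeros:
  assumes "\<forall>y\<in>set h. \<not> snd y" "0 \<le> x" "x \<le> 1"
  shows "arm_likelihood h a x = (1 - x) ^ count_list (map fst h) a"
  using assms by (induction h) (auto simp: arm_likelihood_def split_def)

subsection \<open>Prior weights of histories\<close>

definition moment :: "(nat \<Rightarrow> real measure) \<Rightarrow> (nat \<times> bool) list \<Rightarrow> nat \<Rightarrow> real" where
  "moment P h a = (\<integral>x. arm_likelihood h a x \<partial>P a)"

definition first_moment :: "(nat \<Rightarrow> real measure) \<Rightarrow> (nat \<times> bool) list \<Rightarrow> nat \<Rightarrow> real" where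
  "first_moment P h a = (\<integral>x. x * arm_likelihood h a x \<partial>P a)"

definition evidence :: "nat set \<Rightarrow> (nat \<Rightarrow> real measure) \<Rightarrow> (nat \<times> bool) list \<Rightarrow> real" where
  "evidence A P h = (\<Prod>a\<in>A. moment P h a)"

text \<open>Divided by \<open>evidence A P h\<close>, this is the posterior mean of arm
  \<open>k\<close> given \<open>h\<close>. The unnormalised form avoids division on histories of
  prior probability zero and is additive over the next reward.\<close>

definition weighted_mean ::
    "nat set \<Rightarrow> (nat \<Rightarrow> real measure) \<Rightarrow> nat \<Rightarrow> (nat \<times> bool) list \<Rightarrow> real" where
  "weighted_mean A P k h = first_moment P h k * (\<Prod>a\<in>A - {k}. moment P h a)"

locale bandit =
  fixes A :: "nat set" and P :: "nat \<Rightarrow> real measure"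
  assumes valid: "valid_instance A P"
begin

abbreviation "W \<equiv> evidence A P"
abbreviation "V \<equiv> weighted_mean A P"
abbreviation "m \<equiv> prior_mean P"

lemma finite_A: "finite A" and A_nonempty: "A \<noteq> {}"
  using valid by (auto simp: valid_instance_def)

lemma prob_space_arm: "i \<in> A \<Longrightarrow> prob_space (P i)"
  and sets_arm: "i \<in> A \<Longrightarrow> sets (P i) = sets borel"
  using valid by (auto simp: valid_instance_def)

lemma space_arm: "i \<in> A \<Longrightarrow> space (P i) = UNIV"
  using sets_eq_imp_space_eq[OF sets_arm] by simp

lemma measurable_arm: "i \<in> A \<Longrightarrow> f \<in> borel_measurable borel \<Longrightarrow> f \<in> borel_measurable (P i)"
  using measurable_cong_sets[OF sets_arm refl] by blast

lemma AE_arm: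
  assumes "i \<in> A"
  shows "AE x in P i. 0 \<le> x \<and> x \<le> 1"
proof -
  interpret prob_space "P i" by (rule prob_space_arm[OF assms])
  have "prob {0..1} = 1"
    using valid assms by (auto simp: valid_instance_def)
  then have "AE x in P i. x \<in> {0..1}"
    using prob_eq_1[of "{0..1}"] sets_arm[OF assms] by simp
  then show ?thesis
    by (auto elim: eventually_mono)
qed

lemma integrable_arm:
  fixes B :: real
  assumes "i \<in> A" "f \<in> borel_measurable borel" "\<And>x. 0 \<le> x \<Longrightarrow> x \<le> 1 \<Longrightarrow> \<bar>f x\<bar> \<le> B"
  shows "integrable (P i) f"
proof -
  interpret prob_space "P i" by (rule prob_space_arm[OF assms(1)])
  show ?thesis
    by (rule integrable_const_bound[where B = B])
      (use AE_arm[OF assms(1)] assms in \<open>auto intro: measurable_arm elim: eventually_mono\<close>)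
qed

lemma integrable_likelihood: "i \<in> A \<Longrightarrow> integrable (P i) (arm_likelihood h a)"
  by (rule integrable_arm[where B = 1])
    (auto simp: arm_likelihood_nonneg arm_likelihood_le_1)

lemma integrable_mean_likelihood: "i \<in> A \<Longrightarrow> integrable (P i) (\<lambda>x. x * arm_likelihood h a x)"
  by (rule integrable_arm[where B = 1])
    (auto simp: abs_mult arm_likelihood_nonneg arm_likelihood_le_1 intro: mult_le_one)

lemma prior_integral_prod:
  fixes f :: "nat \<Rightarrow> real \<Rightarrow> real"
  assumes "\<And>i. i \<in> A \<Longrightarrow> integrable (P i) (f i)"
  shows "(\<integral>\<mu>. (\<Prod>i\<in>A. f i (\<mu> i)) \<partial>prior A P) = (\<Prod>i\<in>A. \<integral>x. f i x \<partial>P i)"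
    and "integrable (prior A P) (\<lambda>\<mu>. \<Prod>i\<in>A. f i (\<mu> i))"
proof -
  \<comment> \<open>The theorems on product measures ask for a probability measure at every index;
    \<open>P\<close> is arbitrary outside \<open>A\<close>, so a point mass is put there.\<close>
  define Q where "Q i = (if i \<in> A then P i else return borel 0)" for i
  interpret Q: prob_space "Q i" for i
    by (auto simp: Q_def prob_space_arm intro: prob_space_return)
  interpret product_sigma_finite Q
    by standard
  have prior: "prior A P = PiM A Q"
    unfolding prior_def by (intro PiM_cong) (auto simp: Q_def)
  have int: "integrable (Q i) (f i)" if "i \<in> A" for i
    using that assms by (simp add: Q_def)
  have "(\<integral>\<mu>. (\<Prod>i\<in>A. f i (\<mu> i)) \<partial>prior A P) = (\<Prod>i\<in>A. \<integral>x. f i x \<partial>Q i)"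
    unfolding prior by (intro product_integral_prod finite_A int)
  then show "(\<integral>\<mu>. (\<Prod>i\<in>A. f i (\<mu> i)) \<partial>prior A P) = (\<Prod>i\<in>A. \<integral>x. f i x \<partial>P i)"
    by (simp add: Q_def cong: prod.cong)
  show "integrable (prior A P) (\<lambda>\<mu>. \<Prod>i\<in>A. f i (\<mu> i))"
    unfolding prior by (intro product_integrable_prod finite_A int)
qed

lemma integral_reward_weight:
  assumes "h \<in> histories A t"
  shows "(\<integral>\<mu>. reward_weight \<mu> h \<partial>prior A P) = W h"
    and "integrable (prior A P) (\<lambda>\<mu>. reward_weight \<mu> h)"
  using prior_integral_prod[of "\<lambda>a. arm_likelihood h a"] integrable_likelihood
  by (simp_all add: reward_weight_eq_prod[OF finite_A assms] evidence_def moment_def)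

lemma integral_mean_reward_weight:
  assumes "h \<in> histories A t" "k \<in> A"
  shows "(\<integral>\<mu>. \<mu> k * reward_weight \<mu> h \<partial>prior A P) = V k h"
    and "integrable (prior A P) (\<lambda>\<mu>. \<mu> k * reward_weight \<mu> h)"
proof -
  \<comment> \<open>The extra factor \<open>\<mu> k\<close> is absorbed into coordinate
    \<open>k\<close>, so the integrand remains a product over arms.\<close>
  define f where "f a x = (if a = k then x else 1) * arm_likelihood h a x" for a x
  have int: "integrable (P a) (f a)" if "a \<in> A" for a
    using that integrable_likelihood[OF that] integrable_mean_likelihood[OF that]
    by (cases "a = k") (simp_all add: f_def[abs_def])
  have eq: "(\<Prod>a\<in>A. f a (\<mu> a)) = \<mu> k * reward_weight \<mu> h" for \<mu>
    by (simp add: reward_weight_eq_prod[OF finite_A assms(1)] f_def prod.distrib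
        finite_A assms(2) prod.delta)
  have "(\<Prod>a\<in>A. \<integral>x. f a x \<partial>P a) = (\<integral>x. f k x \<partial>P k) * (\<Prod>a\<in>A - {k}. \<integral>x. f a x \<partial>P a)"
    by (rule prod.remove[OF finite_A assms(2)])
  also have "(\<Prod>a\<in>A - {k}. \<integral>x. f a x \<partial>P a) = (\<Prod>a\<in>A - {k}. moment P h a)"
    by (intro prod.cong) (auto simp: f_def moment_def)
  also have "(\<integral>x. f k x \<partial>P k) * \<dots> = V k h"
    by (simp add: f_def weighted_mean_def first_moment_def)
  finally show "(\<integral>\<mu>. \<mu> k * reward_weight \<mu> h \<partial>prior A P) = V k h"
    using prior_integral_prod(1)[of f] int by (simp add: eq)
  show "integrable (prior A P) (\<lambda>\<mu>. \<mu> k * reward_weight \<mu> h)"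
    using prior_integral_prod(2)[of f] int by (simp add: eq)
qed

section \<open>BIC quantities as finite sums over histories\<close>

lemma histories_mono: "B \<subseteq> C \<Longrightarrow> histories B t \<subseteq> histories C t"
  by (auto simp: histories_def)

text \<open>Policy weights are constants for the integral over the prior, which sees only the reward
  likelihood. Admitting \<open>B \<subseteq> A\<close> serves algorithms confined to the undominated
  arms.\<close>

lemma prob_rec_eq:
  assumes "is_algorithm B \<pi>" "B \<subseteq> A"
  shows "prob_rec A P \<pi> t i = (\<Sum>h\<in>histories B t. policy_weight \<pi> h * pmf (\<pi> h) i * W h)"
proof -
  have h: "h \<in> histories A t" if "h \<in> histories B t" for h
    using that histories_mono[OF assms(2)] by blast
  show ?thesis
    unfolding prob_rec_def pmf_recommendation[OF assms(1) finite_subset[OF assms(2) finite_A]]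
    using h by (simp add: Bochner_Integration.integral_sum integral_reward_weight[of _ t])
qed

lemma gap_rec_eq:
  assumes "is_algorithm B \<pi>" "B \<subseteq> A" "i \<in> A" "j \<in> A"
  shows "gap_rec A P \<pi> t i j =
    (\<Sum>h\<in>histories B t. policy_weight \<pi> h * pmf (\<pi> h) i * (V i h - V j h))"
proof -
  have h: "h \<in> histories A t" if "h \<in> histories B t" for h
    using that histories_mono[OF assms(2)] by blast
  have "(\<mu> i - \<mu> j) * (\<Sum>h\<in>histories B t. policy_weight \<pi> h * pmf (\<pi> h) i * reward_weight \<mu> h) =
    (\<Sum>h\<in>histories B t. policy_weight \<pi> h * pmf (\<pi> h) i *
      (\<mu> i * reward_weight \<mu> h - \<mu> j * reward_weight \<mu> h))" for \<mu>
    by (simp add: sum_distrib_left algebra_simps)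
  then show ?thesis
    unfolding gap_rec_def pmf_recommendation[OF assms(1) finite_subset[OF assms(2) finite_A]]
    using h assms(3,4)
    by (simp add: Bochner_Integration.integral_sum Bochner_Integration.integral_diff
        integral_mean_reward_weight[of _ t])
qed

section \<open>Unsampled arms and bounds on posterior means\<close>

lemma moment_unsampled: "a \<in> A \<Longrightarrow> a \<notin> fst ` set h \<Longrightarrow> moment P h a = 1"
  using prob_space.prob_space[OF prob_space_arm] by (simp add: moment_def arm_likelihood_unsampled)

lemma first_moment_unsampled: "a \<notin> fst ` set h \<Longrightarrow> first_moment P h a = m a"
  by (simp add: first_moment_def arm_likelihood_unsampled prior_mean_def)

lemma W_remove: "k \<in> A \<Longrightarrow> W h = moment P h k * (\<Prod>a\<in>A - {k}. moment P h a)"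
  unfolding evidence_def by (rule prod.remove[OF finite_A])

text \<open>By independence, samples of other arms carry no information about \<open>k\<close>, so
  its posterior mean is still its prior mean.\<close>

lemma V_unsampled: "k \<in> A \<Longrightarrow> k \<notin> fst ` set h \<Longrightarrow> V k h = m k * W h"
  by (simp add: weighted_mean_def W_remove moment_unsampled first_moment_unsampled)

lemma W_Nil: "W [] = 1"
  by (simp add: evidence_def moment_unsampled)

lemma V_Nil: "k \<in> A \<Longrightarrow> V k [] = m k"
  by (simp add: V_unsampled W_Nil)

lemma moment_nonneg: "0 \<le> moment P h a"
  by (simp add: moment_def arm_likelihood_nonneg integral_nonneg_AE)

lemma W_nonneg: "0 \<le> W h"
  by (simp add: evidence_def moment_nonneg prod_nonneg)

lemma first_moment_ge:
  assumes "k \<in> A" "AE x in P k. c \<le> x"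
  shows "c * moment P h k \<le> first_moment P h k"
proof -
  have "(\<integral>x. c * arm_likelihood h k x \<partial>P k) \<le> (\<integral>x. x * arm_likelihood h k x \<partial>P k)"
    using assms integrable_likelihood integrable_mean_likelihood
    by (intro integral_mono_AE) (auto elim!: eventually_mono intro: mult_right_mono arm_likelihood_nonneg)
  then show ?thesis
    by (simp add: moment_def first_moment_def)
qed

lemma first_moment_le:
  assumes "k \<in> A"
  shows "first_moment P h k \<le> moment P h k"
proof -
  have "(\<integral>x. x * arm_likelihood h k x \<partial>P k) \<le> (\<integral>x. 1 * arm_likelihood h k x \<partial>P k)"
  proof (rule integral_mono_AE)
    show "AE x in P k. x * arm_likelihood h k x \<le> 1 * arm_likelihood h k x"
      using AE_arm[OF assms] by eventually_elim (simp add: mult_left_le_one_le arm_likelihood_nonneg)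
  qed (use assms integrable_likelihood integrable_mean_likelihood in auto)
  then show ?thesis
    by (simp add: moment_def first_moment_def)
qed

text \<open>An almost sure lower bound on a mean survives conditioning on any history. This is the
  form in which domination between arms is used.\<close>

lemma V_ge:
  assumes "k \<in> A" "AE x in P k. c \<le> x"
  shows "c * W h \<le> V k h"
  using mult_right_mono[OF first_moment_ge[OF assms, of h], of "\<Prod>a\<in>A - {k}. moment P h a"]
  by (simp add: W_remove[OF assms(1)] weighted_mean_def moment_nonneg prod_nonneg mult.assoc)

lemma V_nonneg:
  assumes "k \<in> A"
  shows "0 \<le> V k h"
proof -
  have "AE x in P k. 0 \<le> x"
    using AE_arm[OF assms] by (auto elim: eventually_mono)
  from V_ge[OF assms this, of h] show ?thesis
    by simp
qed

lemma V_le_W: "k \<in> A \<Longrightarrow> V k h \<le> W h"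
  by (simp add: W_remove weighted_mean_def mult_right_mono first_moment_le moment_nonneg prod_nonneg)

lemma prior_mean_bounds: "k \<in> A \<Longrightarrow> 0 \<le> m k" "k \<in> A \<Longrightarrow> m k \<le> 1"
  using V_nonneg[of k "[]"] V_le_W[of k "[]"] by (auto simp: V_Nil W_Nil)

section \<open>Splitting weights over the next reward\<close>

lemma reward_weight_snoc:
  "reward_weight \<mu> (h @ [(a, True)]) + reward_weight \<mu> (h @ [(a, False)]) = reward_weight \<mu> h"
  by (simp add: reward_weight_def pmf_bernoulli_clamp algebra_simps)

lemma snoc_histories: "h \<in> histories B t \<Longrightarrow> a \<in> B \<Longrightarrow> h @ [(a, r)] \<in> histories B (Suc t)"
  by (auto simp: histories_def)

text \<open>The likelihoods of the two possible next rewards add up to one. The same splitting for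
  \<open>V\<close> expresses that posterior means form a martingale.\<close>

lemma W_snoc:
  assumes "h \<in> histories A t" "a \<in> A"
  shows "W (h @ [(a, True)]) + W (h @ [(a, False)]) = W h"
proof -
  have "W (h @ [(a, True)]) + W (h @ [(a, False)]) =
      (\<integral>\<mu>. reward_weight \<mu> (h @ [(a, True)]) + reward_weight \<mu> (h @ [(a, False)]) \<partial>prior A P)"
    using integral_reward_weight[OF snoc_histories[OF assms]] by simp
  then show ?thesis
    using integral_reward_weight[OF assms(1)] by (simp add: reward_weight_snoc)
qed

lemma V_snoc:
  assumes "h \<in> histories A t" "a \<in> A" "k \<in> A"
  shows "V k (h @ [(a, True)]) + V k (h @ [(a, False)]) = V k h"
proof -
  have "V k (h @ [(a, True)]) + V k (h @ [(a, False)]) =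
      (\<integral>\<mu>. \<mu> k * reward_weight \<mu> (h @ [(a, True)]) + \<mu> k * reward_weight \<mu> (h @ [(a, False)]) \<partial>prior A P)"
    using integral_mean_reward_weight[OF snoc_histories[OF assms(1,2)] assms(3)] by simp
  also have "\<dots> = (\<integral>\<mu>. \<mu> k * reward_weight \<mu> h \<partial>prior A P)"
    by (simp add: reward_weight_snoc flip: distrib_left)
  finally show ?thesis
    using integral_mean_reward_weight[OF assms(1,3)] by simp
qed

lemma W_le_take: "h \<in> histories A t \<Longrightarrow> W h \<le> W (take n h)"
proof (induction t arbitrary: h)
  case (Suc t)
  then obtain g a r where h: "h = g @ [(a, r)]" and g: "g \<in> histories A t" and a: "a \<in> A"
    by (auto simp: histories_Suc)
  have "W h \<le> W g"
    using W_snoc[OF g a] W_nonneg[of "g @ [(a, True)]"] W_nonneg[of "g @ [(a, False)]"]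
    by (cases r) (auto simp: h)
  moreover have "W g \<le> W (take n g)"
    by (rule Suc.IH[OF g])
  moreover have "take n h = h \<or> take n h = take n g"
    by (auto simp: h)
  ultimately show ?case
    by auto
qed simp

section \<open>Domination and long runs of zero rewards\<close>

lemma not_dominated_iff:
  assumes "j \<in> A"
  shows "not_dominated P i j \<longleftrightarrow> \<not> (AE x in P j. m i \<le> x)"
proof -
  interpret prob_space "P j" by (rule prob_space_arm[OF assms])
  have *: "{x \<in> space (P j). \<not> m i \<le> x} = {x. x < m i}"
    using space_arm[OF assms] by auto
  have "(AE x in P j. m i \<le> x) \<longleftrightarrow> prob {x. x < m i} = 0"
    using sets_arm[OF assms] AE_iff_measurable[of "{x. x < m i}" "P j" "\<lambda>x. m i \<le> x"]
    by (auto simp: * emeasure_eq_measure)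
  then show ?thesis
    by (simp add: not_dominated_def zero_less_measure_iff)
qed

text \<open>After many zero rewards, an arm with mass below \<open>c\<close> has posterior mean
  below \<open>c\<close>. In the integral of \<open>(c - x) * (1 - x) ^ n\<close>, the mass below
  some \<open>d < c\<close> gains at least a multiple of \<open>(1 - d) ^ n\<close>, while values
  above \<open>c\<close> lose at most \<open>(1 - c) ^ n\<close>, which is exponentially
  smaller.\<close>

lemma eventually_zeros_below:
  assumes k: "k \<in> A" and c: "0 \<le> c" "c \<le> 1" and low: "\<not> (AE x in P k. c \<le> x)"
  shows "\<forall>\<^sub>F n in sequentially. (\<integral>x. x * (1 - x) ^ n \<partial>P k) < c * (\<integral>x. (1 - x) ^ n \<partial>P k)"
proof -
  interpret prob_space "P k" by (rule prob_space_arm[OF k])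
  \<comment> \<open>Mass below \<open>c\<close> already lies below \<open>c - 1 / (n + 1)\<close>
    for some \<open>n\<close>, because countably many almost sure events hold
    simultaneously.\<close>
  have "\<exists>n. \<not> (AE x in P k. c - 1 / real (Suc n) \<le> x)"
  proof (rule ccontr)
    assume "\<not> ?thesis"
    then have "AE x in P k. \<forall>n. c - 1 / real (Suc n) \<le> x"
      by (simp add: AE_all_countable)
    then have "AE x in P k. c \<le> x"
    proof (rule eventually_mono)
      fix x assume x: "\<forall>n. c - 1 / real (Suc n) \<le> x"
      show "c \<le> x"
      proof (rule ccontr)
        assume "\<not> c \<le> x"
        then obtain n where "1 / real (Suc n) < c - x"
          using reals_Archimedean[of "c - x"] by (auto simp: inverse_eq_divide)
        with x[rule_format, of n] show False
          by linarith
      qed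
    qed
    with low show False ..
  qed
  then obtain n where n: "\<not> (AE x in P k. c - 1 / real (Suc n) \<le> x)" ..
  define d where "d = c - 1 / real (Suc n)"
  have d: "d < c" "d < 1"
    using c by (auto simp: d_def intro: le_less_trans[of _ "1 - 1 / real (Suc n)"])
  define q where "q = prob {x. x < d}"
  have meas: "{x. x < d} \<in> events"
    using sets_arm[OF k] by simp
  have q: "q > 0"
  proof -
    have "{x \<in> space (P k). \<not> d \<le> x} = {x. x < d}"
      using space_arm[OF k] by auto
    then have "(AE x in P k. d \<le> x) \<longleftrightarrow> q = 0"
      using AE_iff_measurable[OF meas, of "\<lambda>x. d \<le> x"] by (auto simp: q_def emeasure_eq_measure)
    then show ?thesis
      using n by (simp add: d_def q_def zero_less_measure_iff)
  qed
  \<comment> \<open>After division by \<open>(1 - d) ^ n\<close>: the left side is the possible loss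
    above \<open>c\<close>, the right side the guaranteed gain below \<open>d\<close>.\<close>
  have "\<forall>\<^sub>F n in sequentially. ((1 - c) / (1 - d)) ^ n < q * (c - d)"
  proof (rule order_tendstoD(2))
    show "(\<lambda>n. ((1 - c) / (1 - d)) ^ n) \<longlonglongrightarrow> 0"
      using c d by (intro LIMSEQ_realpow_zero) (auto simp: divide_simps)
    show "0 < q * (c - d)"
      using q d by simp
  qed
  then show ?thesis
  proof (rule eventually_mono)
    fix n assume n: "((1 - c) / (1 - d)) ^ n < q * (c - d)"
    \<comment> \<open>\<open>?lo\<close> bounds \<open>(c - x) * (1 - x) ^ n\<close> from below on
      the unit interval: the indicator collects the gain below \<open>d\<close>, the constant covers
      the worst loss above \<open>c\<close>.\<close>
    let ?lo = "\<lambda>x. (c - d) * (1 - d) ^ n * indicator {x. x < d} x - (1 - c) ^ n"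
    have int: "integrable (P k) (\<lambda>x. x * (1 - x) ^ n)" "integrable (P k) (\<lambda>x. (1 - x) ^ n)"
      by (rule integrable_arm[OF k, where B = 1];
          auto simp: abs_mult power_abs intro!: mult_le_one power_le_one)+
    have ind: "integrable (P k) (indicator {x. x < d} :: real \<Rightarrow> real)"
      by (rule integrable_arm[OF k, where B = 1]) (auto simp: indicator_def)
    have "0 < (c - d) * (1 - d) ^ n * q - (1 - c) ^ n"
      using n d by (simp add: power_divide field_simps)
    also have "\<dots> = (\<integral>x. ?lo x \<partial>P k)"
      using meas ind by (simp add: q_def prob_space)
    also have "\<dots> \<le> (\<integral>x. c * (1 - x) ^ n - x * (1 - x) ^ n \<partial>P k)"
    proof (rule integral_mono_AE)
      show "AE x in P k. ?lo x \<le> c * (1 - x) ^ n - x * (1 - x) ^ n"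
        using AE_arm[OF k]
      proof (rule eventually_mono)
        fix x :: real assume x: "0 \<le> x \<and> x \<le> 1"
        have eq: "c * (1 - x) ^ n - x * (1 - x) ^ n = (c - x) * (1 - x) ^ n"
          by (simp add: algebra_simps)
        have nn: "0 \<le> (1 - c) ^ n"
          using c by simp
        consider "x < d" | "d \<le> x" "x \<le> c" | "c < x"
          by linarith
        then show "?lo x \<le> c * (1 - x) ^ n - x * (1 - x) ^ n"
        proof cases
          case 1
          then have "(c - d) * (1 - d) ^ n \<le> (c - x) * (1 - x) ^ n"
            using d x by (intro mult_mono power_mono) auto
          with 1 nn show ?thesis
            by (simp add: eq)
        next
          case 2
          then have "0 \<le> (c - x) * (1 - x) ^ n"
            using x by simp
          with 2 nn show ?thesis
            by (simp add: eq)
        next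
          case 3
          then have "(x - c) * (1 - x) ^ n \<le> 1 * (1 - c) ^ n"
            using x c 3 by (intro mult_mono power_mono) simp_all
          moreover have "(c - x) * (1 - x) ^ n = - ((x - c) * (1 - x) ^ n)"
            by (simp add: algebra_simps)
          moreover have "\<not> x < d"
            using 3 d by simp
          ultimately show ?thesis
            by (simp add: eq)
        qed
      qed
    qed (use int ind in simp_all)
    also have "\<dots> = c * (\<integral>x. (1 - x) ^ n \<partial>P k) - (\<integral>x. x * (1 - x) ^ n \<partial>P k)"
      using int by simp
    finally show "(\<integral>x. x * (1 - x) ^ n \<partial>P k) < c * (\<integral>x. (1 - x) ^ n \<partial>P k)"
      by simp
  qed
qed

end

section \<open>Strict inequalities from non-degenerate supports\<close>

locale nondegenerate_bandit = bandit +
  assumes nondegenerate: "\<forall>i\<in>A. \<not> support_degenerate P i"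
begin

lemma not_AE_two_point:
  assumes "k \<in> A" "0 \<le> c" "c < 1"
  shows "\<not> (AE x in P k. x = c \<or> x = 1)"
proof
  interpret prob_space "P k" by (rule prob_space_arm[OF assms(1)])
  assume "AE x in P k. x = c \<or> x = 1"
  then have "prob {c, 1} = 1"
    using prob_eq_1[of "{c, 1}"] sets_arm[OF assms(1)] by simp
  with assms nondegenerate show False
    by (auto simp: support_degenerate_def)
qed

text \<open>Equality would make \<open>(x - c) * arm_likelihood h k x\<close> vanish almost surely.
  The likelihood is positive inside the unit interval, so the mean would be concentrated on
  \<open>c\<close> and 1, which non-degeneracy forbids.\<close>

lemma first_moment_gt:
  assumes k: "k \<in> A" and c: "0 \<le> c" and ge: "AE x in P k. c \<le> x"
  shows "c * moment P h k < first_moment P h k"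
proof (rule ccontr)
  let ?f = "\<lambda>x. x * arm_likelihood h k x - c * arm_likelihood h k x"
  assume "\<not> ?thesis"
  with first_moment_ge[OF k ge, of h] have "(\<integral>x. ?f x \<partial>P k) = 0"
    using integrable_likelihood[OF k] integrable_mean_likelihood[OF k]
    by (simp add: moment_def first_moment_def)
  moreover have "AE x in P k. 0 \<le> ?f x"
    using ge by eventually_elim (simp add: mult_right_mono arm_likelihood_nonneg)
  ultimately have "AE x in P k. ?f x = 0"
    using integrable_likelihood[OF k] integrable_mean_likelihood[OF k]
    by (subst (asm) integral_nonneg_eq_0_iff_AE) auto
  with ge AE_arm[OF k] have AE: "AE x in P k. (x = c \<or> x = 1) \<and> c \<le> x \<and> x \<le> 1"
  proof eventually_elim
    case (elim x)
    then have "(x - c) * arm_likelihood h k x = 0"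
      by (simp add: algebra_simps)
    with elim c arm_likelihood_pos[of x h k] show ?case
      by (cases "x = c \<or> x = 1") auto
  qed
  show False
  proof (cases "c < 1")
    case True
    with AE show False
      using not_AE_two_point[OF k c] by (auto elim: eventually_mono)
  next
    \<comment> \<open>For \<open>c \<ge> 1\<close> at most the value 1 is left; a point mass there
      is a degenerate support with lower point 0.\<close>
    case False
    with AE have "AE x in P k. x = 0 \<or> x = 1"
      by (auto elim: eventually_mono)
    then show False
      using not_AE_two_point[OF k, of 0] by simp
  qed
qed

lemma prior_mean_gt: "k \<in> A \<Longrightarrow> 0 \<le> c \<Longrightarrow> AE x in P k. c \<le> x \<Longrightarrow> c < m k"
  using first_moment_gt[of k c "[]"] by (simp add: moment_unsampled first_moment_unsampled)

subsection \<open>Restriction to the undominated arms\<close>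

lemma pmf_algorithm_outside: "is_algorithm B \<pi> \<Longrightarrow> i \<notin> B \<Longrightarrow> pmf (\<pi> h) i = 0"
  by (auto simp: is_algorithm_def pmf_eq_0_set_pmf)

text \<open>The ratio may be replaced by its numerator. If \<open>i\<close> has recommendation
  probability zero, every history has zero policy factor or zero evidence, and zero evidence forces
  both weighted means to vanish, so the gap is zero as well.\<close>

lemma BIC_iff:
  assumes "is_algorithm A \<pi>"
  shows "BIC A P \<pi> \<longleftrightarrow> (\<forall>t. \<forall>i\<in>A. \<forall>j\<in>A. 0 \<le> gap_rec A P \<pi> t i j)"
proof -
  have prob_nonneg: "0 \<le> prob_rec A P \<pi> t i" for t i
    by (simp add: prob_rec_eq[OF assms] policy_weight_nonneg W_nonneg sum_nonneg)
  have "gap_rec A P \<pi> t i j = 0" if "i \<in> A" "j \<in> A" "prob_rec A P \<pi> t i = 0" for t i j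
  proof -
    have "policy_weight \<pi> h * pmf (\<pi> h) i * W h = 0" if "h \<in> histories A t" for h
      using \<open>prob_rec A P \<pi> t i = 0\<close> that finite_histories[OF finite_A]
      by (simp add: prob_rec_eq[OF assms] sum_nonneg_eq_0_iff policy_weight_nonneg W_nonneg)
    moreover have "V i h - V j h = 0" if "W h = 0" for h
      using V_nonneg[of i h] V_le_W[of i h] V_nonneg[of j h] V_le_W[of j h] that \<open>i \<in> A\<close> \<open>j \<in> A\<close>
      by simp
    ultimately have "policy_weight \<pi> h * pmf (\<pi> h) i * (V i h - V j h) = 0" if "h \<in> histories A t" for h
      using that by fastforce
    then show ?thesis
      unfolding gap_rec_eq[OF assms order_refl \<open>i \<in> A\<close> \<open>j \<in> A\<close>] by (intro sum.neutral ballI)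
  qed
  then have "0 \<le> gap_rec A P \<pi> t i j \<longleftrightarrow>
      (prob_rec A P \<pi> t i > 0 \<longrightarrow> gap_rec A P \<pi> t i j / prob_rec A P \<pi> t i \<ge> 0)"
    if "i \<in> A" "j \<in> A" for t i j
    using that prob_nonneg[of t i] by (cases "prob_rec A P \<pi> t i = 0") (auto simp: zero_le_divide_iff)
  then show ?thesis
    unfolding BIC_def by blast
qed

section \<open>Undominated arms and the reduction of BIC to them\<close>

abbreviation "S \<equiv> S_arms A P"

lemma S_subset: "S \<subseteq> A"
  by (auto simp: S_arms_def)

text \<open>Among the arms dominating \<open>j\<close>, one of greatest prior mean lies in
  \<open>S\<close>: an arm dominating it would also dominate \<open>j\<close> and, by
  non-degeneracy, have a strictly larger prior mean.\<close>

lemma ex_dominating_arm: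
  assumes "j \<in> A - S"
  shows "\<exists>k\<in>S. AE x in P k. m j \<le> x"
proof -
  define D where "D j = {k \<in> A. AE x in P k. m j \<le> x}" for j
  have gt: "m j < m k" if "j \<in> A" "k \<in> D j" for j k
    using that prior_mean_gt[of k "m j"] prior_mean_bounds(1)[of j] by (auto simp: D_def)
  have D_ne: "D j \<noteq> {}" if "j \<in> A - S" for j
    using that not_dominated_iff by (auto simp: S_arms_def D_def)
  have "finite (m ` D j)" "m ` D j \<noteq> {}"
    using D_ne[OF assms] finite_A by (auto simp: D_def)
  then have "Max (m ` D j) \<in> m ` D j" and max: "\<And>k. k \<in> D j \<Longrightarrow> m k \<le> Max (m ` D j)"
    by auto
  then obtain k where k: "k \<in> D j" and km: "m k = Max (m ` D j)"
    by auto
  have "k \<in> S"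
  proof (rule ccontr)
    assume "k \<notin> S"
    then obtain l where l: "l \<in> D k"
      using D_ne[of k] k by (auto simp: D_def)
    have "m j < m k"
      using gt[OF _ k] assms by simp
    then have "AE x in P l. m j \<le> x"
      using l by (auto simp: D_def elim: eventually_mono)
    then have "l \<in> D j"
      using l by (simp add: D_def)
    then have "m l \<le> m k"
      using max km by simp
    moreover have "m k < m l"
      using gt[OF _ l] k by (simp add: D_def)
    ultimately show False
      by simp
  qed
  with k show ?thesis
    by (auto simp: D_def)
qed

lemma S_nonempty: "S \<noteq> {}"
proof -
  obtain j where "j \<in> A"
    using A_nonempty by auto
  then show ?thesis
    using ex_dominating_arm[of j] by (cases "j \<in> S") auto
qed

lemma is_algorithm_mono: "is_algorithm B \<pi> \<Longrightarrow> B \<subseteq> C \<Longrightarrow> is_algorithm C \<pi>"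
  by (auto simp: is_algorithm_def)

text \<open>An arm \<open>j\<close> outside \<open>S\<close> is never sampled, so its posterior mean
  stays \<open>m j\<close>. Some \<open>k\<close> in \<open>S\<close> is almost surely at least
  \<open>m j\<close>, so the gap of \<open>i\<close> to \<open>j\<close> is at least the gap to
  \<open>k\<close>.\<close>

lemma BIC_if_BIC_on_S:
  assumes alg: "is_algorithm S \<pi>"
    and gap: "\<And>t i j. i \<in> S \<Longrightarrow> j \<in> S \<Longrightarrow> 0 \<le> gap_rec A P \<pi> t i j"
  shows "BIC A P \<pi>"
  unfolding BIC_iff[OF is_algorithm_mono[OF alg S_subset]]
proof (intro allI ballI)
  fix t i j assume i: "i \<in> A" and j: "j \<in> A"
  note gap_eq = gap_rec_eq[OF alg S_subset i]
  show "0 \<le> gap_rec A P \<pi> t i j"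
  proof (cases "i \<in> S")
    case False
    then have "pmf (\<pi> h) i = 0" for h
      by (rule pmf_algorithm_outside[OF alg])
    then show ?thesis
      by (simp add: gap_eq[OF j])
  next
    case iS: True
    show ?thesis
    proof (cases "j \<in> S")
      case False
      then obtain k where k: "k \<in> S" "AE x in P k. m j \<le> x"
        using ex_dominating_arm[of j] j by auto
      then have kA: "k \<in> A"
        using S_subset by auto
      have "gap_rec A P \<pi> t i k \<le> gap_rec A P \<pi> t i j"
        unfolding gap_eq[OF kA] gap_eq[OF j]
      proof (intro sum_mono mult_left_mono)
        fix h assume "h \<in> histories S t"
        then have "j \<notin> fst ` set h"
          using False by (auto simp: histories_def)
        then have "V j h \<le> V k h"
          using V_unsampled[OF j] V_ge[OF kA k(2)] by simp
        then show "V i h - V k h \<le> V i h - V j h"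
          by simp
      qed (simp add: policy_weight_nonneg)
      with gap[OF iS k(1), of t] show ?thesis
        by simp
    qed (simp add: gap iS)
  qed
qed

text \<open>In the first round where \<open>i\<close> has positive recommendation probability, its
  posterior mean is still \<open>m i\<close>. A non-degenerate arm that is almost surely at least
  \<open>m i\<close> then has a strictly larger posterior mean, which contradicts BIC.\<close>

lemma recommended_imp_S:
  assumes alg: "is_algorithm A \<pi>" and "BIC A P \<pi>" and "prob_rec A P \<pi> t i > 0"
  shows "i \<in> S"
proof -
  define s where "s = (LEAST s. prob_rec A P \<pi> s i > 0)"
  have s: "prob_rec A P \<pi> s i > 0"
    unfolding s_def by (rule LeastI) (rule assms)
  have before: "\<not> prob_rec A P \<pi> r i > 0" if "r < s" for r
    using that not_less_Least unfolding s_def by blast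
  have i: "i \<in> A"
  proof (rule ccontr)
    assume "i \<notin> A"
    then have "pmf (\<pi> h) i = 0" for h
      by (rule pmf_algorithm_outside[OF alg])
    with s show False
      by (simp add: prob_rec_eq[OF alg])
  qed
  \<comment> \<open>A sample of \<open>i\<close> at position \<open>n\<close> would give, through
    the prefix of length \<open>n\<close>, a positive recommendation probability in an earlier
    round.\<close>
  have unsampled: "i \<notin> fst ` set h"
    if h: "h \<in> histories A s" and pos: "policy_weight \<pi> h \<noteq> 0" "W h \<noteq> 0" for h
  proof
    assume "i \<in> fst ` set h"
    then obtain n where n: "n < length h" "fst (h ! n) = i"
      by (auto simp: in_set_conv_nth)
    have tk: "take n h \<in> histories A n"
      using h n set_take_subset[of n h] by (auto simp: histories_def)
    have "0 < policy_weight \<pi> (take n h) * pmf (\<pi> (take n h)) i * W (take n h)"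
    proof (intro mult_pos_pos)
      show "0 < policy_weight \<pi> (take n h)"
        using policy_weight_take_nonzero[OF pos(1), of n] policy_weight_nonneg[of \<pi> "take n h"] by linarith
      show "0 < pmf (\<pi> (take n h)) i"
        using policy_weight_nth_nonzero[OF pos(1) n(1)] n(2) by (simp add: order_less_le)
      show "0 < W (take n h)"
        using W_le_take[OF h, of n] W_nonneg[of h] pos(2) by linarith
    qed
    also have "\<dots> \<le> prob_rec A P \<pi> n i"
      unfolding prob_rec_eq[OF alg order_refl]
      using tk by (intro member_le_sum)
        (auto simp: policy_weight_nonneg W_nonneg finite_histories finite_A)
    finally show False
      using before[of n] n h by (simp add: length_histories)
  qed
  have "\<not> (AE x in P j. m i \<le> x)" if j: "j \<in> A" "j \<noteq> i" for j
  proof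
    assume AE: "AE x in P j. m i \<le> x"
    let ?c = "\<lambda>h. policy_weight \<pi> h * pmf (\<pi> h) i"
    have le: "?c h * (V i h - V j h) \<le> 0" and less: "?c h * W h \<noteq> 0 \<Longrightarrow> ?c h * (V i h - V j h) < 0"
      if h: "h \<in> histories A s" for h
    proof -
      have c: "0 \<le> ?c h"
        by (simp add: policy_weight_nonneg)
      have zero: "?c h * (V i h - V j h) = 0" if "?c h * W h = 0"
      proof (cases "W h = 0")
        case True
        then have "V i h = 0" "V j h = 0"
          using V_nonneg[OF i, of h] V_le_W[OF i, of h] V_nonneg[OF j(1), of h] V_le_W[OF j(1), of h]
          by auto
        then show ?thesis
          by simp
      qed (use that in auto)
      show neg: "?c h * (V i h - V j h) < 0" if nz: "?c h * W h \<noteq> 0"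
      proof -
        \<comment> \<open>The strict inequality for the first moment of \<open>j\<close> survives
          multiplication by the moments of the other arms only if these are nonzero, which positive
          evidence guarantees.\<close>
        have "(\<Prod>a\<in>A - {j}. moment P h a) \<noteq> 0"
          using nz by (auto simp: W_remove[OF j(1)])
        then have "0 < (\<Prod>a\<in>A - {j}. moment P h a)"
          by (simp add: order_less_le prod_nonneg moment_nonneg)
        then have "m i * W h < V j h"
          using first_moment_gt[OF j(1) prior_mean_bounds(1)[OF i] AE, of h]
          by (simp add: W_remove[OF j(1)] weighted_mean_def flip: mult.assoc)
        moreover have "V i h = m i * W h"
          using unsampled[OF h] nz by (intro V_unsampled[OF i]) auto
        moreover have "?c h \<noteq> 0"
          using nz by auto
        ultimately show ?thesis
          using c by (intro mult_pos_neg) linarith+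
      qed
      show "?c h * (V i h - V j h) \<le> 0"
      proof (cases "?c h * W h = 0")
        case True
        show ?thesis
          unfolding zero[OF True] by simp
      next
        case False
        then show ?thesis
          using neg by (intro less_imp_le)
      qed
    qed
    \<comment> \<open>Positive recommendation probability supplies one history with a strictly
      negative summand, which makes the whole gap negative.\<close>
    have "(\<Sum>h\<in>histories A s. ?c h * W h) \<noteq> 0"
      using s unfolding prob_rec_eq[OF alg order_refl] by linarith
    then obtain g where g: "g \<in> histories A s" "?c g * W g \<noteq> 0"
      by (rule sum.not_neutral_contains_not_neutral)
    have "gap_rec A P \<pi> s i j < (\<Sum>h\<in>histories A s. 0)"
      unfolding gap_rec_eq[OF alg order_refl i j(1)]
    proof (rule sum_strict_mono_ex1)
      show "\<exists>h\<in>histories A s. ?c h * (V i h - V j h) < 0"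
        using less[OF g] g(1) by (rule bexI)
    qed (use le in \<open>simp_all add: finite_histories finite_A\<close>)
    moreover have "0 \<le> gap_rec A P \<pi> s i j"
      using \<open>BIC A P \<pi>\<close> i j(1) by (simp add: BIC_iff[OF alg])
    ultimately show False
      by simp
  qed
  then show ?thesis
    using i by (auto simp: S_arms_def not_dominated_iff)
qed

section \<open>The restricted instance\<close>

lemma valid_restrict: "B \<subseteq> A \<Longrightarrow> B \<noteq> {} \<Longrightarrow> valid_instance B (restrict P B)"
  using valid finite_subset[OF _ finite_A] by (simp add: valid_instance_def subset_iff)

lemma prior_mean_restrict: "i \<in> B \<Longrightarrow> prior_mean (restrict P B) i = m i"
  by (simp add: prior_mean_def)

lemma pairwise_nondominance_S: "pairwise_nondominance S (restrict P S)"
  by (auto simp: pairwise_nondominance_def not_dominated_def prior_mean_restrict)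
    (auto simp: S_arms_def not_dominated_def)

text \<open>Arms outside \<open>B\<close> are unsampled in \<open>h\<close>, so their moments are 1
  and drop out of the products.\<close>

lemma weights_restrict:
  assumes "B \<subseteq> A" "h \<in> histories B t"
  shows "evidence B (restrict P B) h = W h"
    and "k \<in> B \<Longrightarrow> weighted_mean B (restrict P B) k h = V k h"
proof -
  have out: "moment P h a = 1" if "a \<in> A" "a \<notin> B" for a
    using that assms(2) by (intro moment_unsampled) (auto simp: histories_def)
  have res: "moment (restrict P B) h a = moment P h a"
    "first_moment (restrict P B) h a = first_moment P h a" if "a \<in> B" for a
    using that by (auto simp: moment_def first_moment_def)
  \<comment> \<open>\<open>K = {}\<close> gives the evidence, \<open>K = {k}\<close> the weighted
    mean of \<open>k\<close>.\<close>
  have prod: "(\<Prod>a\<in>B - K. moment (restrict P B) h a) = (\<Prod>a\<in>A - K. moment P h a)" for K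
    using assms(1) finite_A out by (intro prod.mono_neutral_cong_left) (auto simp: res)
  show "evidence B (restrict P B) h = W h"
    using prod[of "{}"] by (simp add: evidence_def)
  show "weighted_mean B (restrict P B) k h = V k h" if "k \<in> B"
    using prod[of "{k}"] res that by (simp add: weighted_mean_def)
qed

lemma gap_rec_restrict:
  assumes "is_algorithm B \<pi>" "B \<subseteq> A" "i \<in> B" "j \<in> B"
  shows "gap_rec B (restrict P B) \<pi> t i j = gap_rec A P \<pi> t i j"
proof -
  interpret B: bandit B "restrict P B"
    by standard (use assms in \<open>auto intro: valid_restrict\<close>)
  have "i \<in> A" "j \<in> A"
    using assms by auto
  then show ?thesis
    unfolding B.gap_rec_eq[OF assms(1) order_refl assms(3,4)] gap_rec_eq[OF assms(1,2) \<open>i \<in> A\<close> \<open>j \<in> A\<close>]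
    by (intro sum.cong) (auto simp: weights_restrict[OF assms(2)] assms)
qed

lemma nondegenerate_restrict:
  assumes "B \<subseteq> A" "B \<noteq> {}"
  shows "nondegenerate_bandit B (restrict P B)"
  by standard (use assms nondegenerate in \<open>auto intro: valid_restrict simp: support_degenerate_def\<close>)

lemma BIC_restrict_S:
  assumes "is_algorithm S \<pi>" "BIC S (restrict P S) \<pi>"
  shows "BIC A P \<pi>"
proof (rule BIC_if_BIC_on_S[OF assms(1)])
  interpret B: nondegenerate_bandit S "restrict P S"
    by (rule nondegenerate_restrict[OF S_subset S_nonempty])
  fix t i j assume "i \<in> S" "j \<in> S"
  moreover from this have "0 \<le> gap_rec S (restrict P S) \<pi> t i j"
    using assms(2) unfolding B.BIC_iff[OF assms(1)] by blast
  ultimately show "0 \<le> gap_rec A P \<pi> t i j"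
    by (simp add: gap_rec_restrict[OF assms(1) S_subset])
qed

subsection \<open>Exploring a new arm\<close>

text \<open>With \<open>v = V i - V k\<close> this integrates \<open>F\<close> against a signed
  measure on histories; taking for \<open>F\<close> the probability of recommending \<open>i\<close>
  yields the BIC gap.\<close>

definition expect ::
    "policy \<Rightarrow> ((nat \<times> bool) list \<Rightarrow> real) \<Rightarrow> nat \<Rightarrow> ((nat \<times> bool) list \<Rightarrow> real) \<Rightarrow> real" where
  "expect \<pi> v t F = (\<Sum>h\<in>histories S t. policy_weight \<pi> h * v h * F h)"

text \<open>The consistency condition under which the signed weights of longer histories project
  onto those of shorter ones, as for a martingale.\<close>

definition harmonic :: "((nat \<times> bool) list \<Rightarrow> real) \<Rightarrow> bool" where
  "harmonic v \<longleftrightarrow> (\<forall>t. \<forall>h\<in>histories S t. \<forall>a\<in>S. v (h @ [(a, True)]) + v (h @ [(a, False)]) = v h)"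

lemma harmonic_V_diff:
  assumes "i \<in> S" "k \<in> S"
  shows "harmonic (\<lambda>h. V i h - V k h)"
  unfolding harmonic_def
proof (intro allI ballI)
  fix t h a assume "h \<in> histories S t" "a \<in> S"
  then have "h \<in> histories A t" "a \<in> A"
    using histories_mono[OF S_subset] S_subset by auto
  then show "V i (h @ [(a, True)]) - V k (h @ [(a, True)]) +
      (V i (h @ [(a, False)]) - V k (h @ [(a, False)])) = V i h - V k h"
    using V_snoc[of h t a i] V_snoc[of h t a k] assms[THEN subsetD[OF S_subset]] by simp
qed

lemma finite_S: "finite S"
  using S_subset finite_A finite_subset by blast

lemma expect_cong:
  assumes "\<And>h. h \<in> histories S t \<Longrightarrow> policy_weight \<pi> h \<noteq> 0 \<Longrightarrow> F h = G h"
  shows "expect \<pi> v t F = expect \<pi> v t G"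
  unfolding expect_def by (intro sum.cong) (use assms in auto)

lemma expect_add: "expect \<pi> v t (\<lambda>h. F h + G h) = expect \<pi> v t F + expect \<pi> v t G"
  by (simp add: expect_def algebra_simps sum.distrib)

lemma expect_diff: "expect \<pi> v t (\<lambda>h. F h - G h) = expect \<pi> v t F - expect \<pi> v t G"
  by (simp add: expect_def algebra_simps sum_subtractf)

lemma expect_cmult: "expect \<pi> v t (\<lambda>h. c * F h) = c * expect \<pi> v t F"
  by (simp add: expect_def sum_distrib_left mult.left_commute)

lemma expect_policy_cong:
  assumes "\<And>h. length h < t \<Longrightarrow> \<pi> h = \<pi>' h"
  shows "expect \<pi> v t F = expect \<pi>' v t F"
proof -
  have "policy_weight \<pi> h = policy_weight \<pi>' h" if "h \<in> histories S t" for h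
    using that assms by (intro policy_weight_cong) (simp add: length_histories)
  then show ?thesis
    by (simp add: expect_def)
qed

text \<open>If \<open>F\<close> ignores the newest reward, harmonicity sums that reward out and only
  the choice of the newest arm remains.\<close>

lemma expect_Suc:
  assumes "harmonic v"
    and "\<And>h a r. length h = t \<Longrightarrow> F (h @ [(a, r)]) = G h a"
  shows "expect \<pi> v (Suc t) F = expect \<pi> v t (\<lambda>h. \<Sum>a\<in>S. pmf (\<pi> h) a * G h a)"
  unfolding expect_def sum_histories_Suc sum_distrib_left
proof (intro sum.cong refl)
  fix h a assume h: "h \<in> histories S t" and a: "a \<in> S"
  have v: "v h = v (h @ [(a, True)]) + v (h @ [(a, False)])"
    using assms(1) h a by (simp add: harmonic_def)
  show "policy_weight \<pi> (h @ [(a, True)]) * v (h @ [(a, True)]) * F (h @ [(a, True)]) +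
      policy_weight \<pi> (h @ [(a, False)]) * v (h @ [(a, False)]) * F (h @ [(a, False)]) =
      policy_weight \<pi> h * v h * (pmf (\<pi> h) a * G h a)"
    using length_histories[OF h] by (simp add: assms(2) v algebra_simps)
qed

lemma sum_policy: "is_algorithm S \<pi> \<Longrightarrow> (\<Sum>a\<in>S. pmf (\<pi> h) a) = 1"
  by (intro sum_pmf_eq_1 finite_S) (simp add: is_algorithm_def)

text \<open>The tower property: whatever is determined by the first \<open>t\<close> rounds is
  unaffected by how the algorithm continues.\<close>

lemma expect_take:
  assumes "is_algorithm S \<pi>" "harmonic v"
  shows "expect \<pi> v (t + n) (\<lambda>h. F (take t h)) = expect \<pi> v t F"
proof (induction n)
  case 0
  show ?case
    by (auto intro!: expect_cong simp: length_histories)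
next
  case (Suc n)
  have "expect \<pi> v (Suc (t + n)) (\<lambda>h. F (take t h)) =
      expect \<pi> v (t + n) (\<lambda>h. \<Sum>a\<in>S. pmf (\<pi> h) a * F (take t h))"
    by (rule expect_Suc[OF assms(2)]) simp
  also have "\<dots> = expect \<pi> v (t + n) (\<lambda>h. F (take t h))"
    by (simp add: sum_policy[OF assms(1)] flip: sum_distrib_right)
  finally show ?case
    using Suc.IH by simp
qed

lemma expect_1:
  assumes "is_algorithm S \<pi>" "harmonic v"
  shows "expect \<pi> v t (\<lambda>_. 1) = v []"
  using expect_take[OF assms, of 0 t "\<lambda>_. 1"] by (simp add: expect_def)

lemma gap_rec_eq_expect:
  assumes "is_algorithm S \<pi>" "i \<in> S" "k \<in> S"
  shows "gap_rec A P \<pi> t i k = expect \<pi> (\<lambda>h. V i h - V k h) t (\<lambda>h. pmf (\<pi> h) i)"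
  using gap_rec_eq[OF assms(1) S_subset, of i k t] assms(2,3)[THEN subsetD[OF S_subset]]
  by (simp add: expect_def mult_ac)

text \<open>With hazard rate \<open>1 / (L - n)\<close> in the \<open>n\<close>-th of \<open>L\<close> rounds, the unconditional probability
  of exploring is \<open>1 / L\<close> in every round, and exploration has surely happened after the last one.\<close>

definition explore ::
    "nat \<Rightarrow> ((nat \<times> bool) list \<Rightarrow> nat) \<Rightarrow> nat \<Rightarrow> nat \<Rightarrow> policy \<Rightarrow> policy" where
  "explore j exploit t L \<pi> h =
    (if length h < t \<or> t + L \<le> length h then \<pi> h
     else if j \<in> fst ` set (drop t h) then return_pmf (exploit (take t h))
     else bind_pmf (bernoulli_pmf (1 / real (t + L - length h)))
       (\<lambda>b. return_pmf (if b then j else exploit (take t h))))"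

text \<open>Written as exploitation plus a correction that disappears after exploration, so that
  linearity of \<open>expect\<close> applies. The formula also covers the case where the exploited
  arm is \<open>j\<close> itself.\<close>

lemma pmf_explore:
  assumes "t \<le> length h" "length h < t + L"
  shows "pmf (explore j exploit t L \<pi> h) i = of_bool (exploit (take t h) = i) +
    (if j \<in> fst ` set (drop t h) then 0
     else (of_bool (i = j) - of_bool (exploit (take t h) = i)) / real (t + L - length h))"
proof -
  define p where "p = 1 / real (t + L - length h)"
  have p: "0 \<le> p" "p \<le> 1"
    using assms by (auto simp: p_def)
  have "pmf (bind_pmf (bernoulli_pmf p) (\<lambda>b. return_pmf (if b then j else e))) i =
      of_bool (j = i) * p + of_bool (e = i) * (1 - p)" for e
    using p by (simp add: pmf_bind indicator_def of_bool_def)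
  then have key: "pmf (bind_pmf (bernoulli_pmf p) (\<lambda>b. return_pmf (if b then j else e))) i =
      of_bool (e = i) + (of_bool (i = j) - of_bool (e = i)) * p" for e
    by (auto simp: algebra_simps)
  show ?thesis
  proof (cases "j \<in> fst ` set (drop t h)")
    case True
    then show ?thesis
      using assms by (simp add: explore_def)
  next
    case False
    then have eq: "explore j exploit t L \<pi> h =
        bind_pmf (bernoulli_pmf p) (\<lambda>b. return_pmf (if b then j else exploit (take t h)))"
      using assms by (simp add: explore_def p_def)
    show ?thesis
      unfolding eq key using False by (simp add: p_def)
  qed
qed

lemma is_algorithm_explore:
  assumes "is_algorithm S \<pi>" "j \<in> S" "\<And>h. exploit h \<in> S"
  shows "is_algorithm S (explore j exploit t L \<pi>)"
  using assms by (auto simp: is_algorithm_def explore_def)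

lemma explore_cong: "length h < t \<Longrightarrow> explore j exploit t L \<pi> h = \<pi> h"
  by (simp add: explore_def)

text \<open>The survival factors \<open>1 - 1 / (L - n)\<close> telescope to
  \<open>1 - n / L\<close>. If the exploited arm is \<open>j\<close>, it is chosen at once and these
  hazard rates do not govern the event; hence \<open>\<phi>\<close> must vanish there.\<close>

lemma expect_unexplored:
  assumes alg: "is_algorithm S \<pi>" and j: "j \<in> S" and ex: "\<And>h. exploit h \<in> S"
    and v: "harmonic v" and n: "n \<le> L" and L: "0 < L"
    and \<phi>: "\<And>h. exploit h = j \<Longrightarrow> \<phi> h = 0"
  shows "expect (explore j exploit t L \<pi>) v (t + n)
      (\<lambda>h. if j \<in> fst ` set (drop t h) then 0 else \<phi> (take t h)) =
    (1 - real n / real L) * expect \<pi> v t \<phi>"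
  using n
proof (induction n)
  case 0
  have "expect (explore j exploit t L \<pi>) v t (\<lambda>h. if j \<in> fst ` set (drop t h) then 0 else \<phi> (take t h)) =
      expect (explore j exploit t L \<pi>) v t \<phi>"
    by (rule expect_cong) (simp add: length_histories)
  also have "\<dots> = expect \<pi> v t \<phi>"
    by (rule expect_policy_cong) (rule explore_cong)
  finally show ?case
    by simp
next
  case (Suc n)
  let ?\<pi> = "explore j exploit t L \<pi>"
  let ?F = "\<lambda>h. if j \<in> fst ` set (drop t h) then 0 else \<phi> (take t h)"
  have alg': "is_algorithm S ?\<pi>"
    by (rule is_algorithm_explore[OF alg j ex])
  have "expect ?\<pi> v (Suc (t + n)) ?F =
      expect ?\<pi> v (t + n) (\<lambda>h. \<Sum>a\<in>S. pmf (?\<pi> h) a * (if a = j then 0 else ?F h))"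
    by (rule expect_Suc[OF v]) auto
  also have "\<dots> = expect ?\<pi> v (t + n) (\<lambda>h. (1 - 1 / real (L - n)) * ?F h)"
  proof (rule expect_cong)
    fix h assume h: "h \<in> histories S (t + n)"
    have "(\<Sum>a\<in>S. pmf (?\<pi> h) a * (if a = j then 0 else ?F h)) = (\<Sum>a\<in>S - {j}. pmf (?\<pi> h) a) * ?F h"
      unfolding sum_distrib_right by (rule sum.mono_neutral_cong_right) (auto simp: finite_S)
    also have "(\<Sum>a\<in>S - {j}. pmf (?\<pi> h) a) = 1 - pmf (?\<pi> h) j"
      using sum_policy[OF alg', of h] sum.remove[OF finite_S j, of "pmf (?\<pi> h)"] by simp
    also have "(1 - pmf (?\<pi> h) j) * ?F h = (1 - 1 / real (L - n)) * ?F h"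
    proof (cases "?F h = 0")
      case False
      then have "j \<notin> fst ` set (drop t h)" "exploit (take t h) \<noteq> j"
        using \<phi> by (auto split: if_splits)
      then have "pmf (?\<pi> h) j = 1 / real (L - n)"
        using h Suc.prems by (subst pmf_explore) (auto simp: length_histories)
      then show ?thesis
        by simp
    qed simp
    finally show "(\<Sum>a\<in>S. pmf (?\<pi> h) a * (if a = j then 0 else ?F h)) = (1 - 1 / real (L - n)) * ?F h" .
  qed
  also have "\<dots> = (1 - 1 / real (L - n)) * ((1 - real n / real L) * expect \<pi> v t \<phi>)"
    unfolding expect_cmult using Suc by simp
  also have "\<dots> = (1 - real (Suc n) / real L) * expect \<pi> v t \<phi>"
    using Suc.prems L by (simp add: field_simps of_nat_diff)
  finally show ?case
    by simp
qed

text \<open>Survival \<open>1 - n / L\<close> times hazard \<open>1 / (L - n)\<close> is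
  \<open>1 / L\<close> in every round of the block. Each round therefore has the gap of the same
  mixture: exploitation with weight \<open>1 - 1 / L\<close>, unconditional choice of
  \<open>j\<close> with weight \<open>1 / L\<close>.\<close>

lemma expect_explore:
  assumes alg: "is_algorithm S \<pi>" and j: "j \<in> S" and ex: "\<And>h. exploit h \<in> S"
    and v: "harmonic v" and n: "n < L"
  shows "expect (explore j exploit t L \<pi>) v (t + n) (\<lambda>h. pmf (explore j exploit t L \<pi> h) i) =
    (1 - 1 / real L) * expect \<pi> v t (\<lambda>h. of_bool (exploit h = i)) + of_bool (i = j) * v [] / real L"
proof -
  let ?\<pi> = "explore j exploit t L \<pi>"
  \<comment> \<open>Where \<open>exploit h = j\<close> the two indicators agree, so
    \<open>?\<phi>\<close> vanishes as \<open>expect_unexplored\<close> demands.\<close>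
  let ?\<phi> = "\<lambda>h. of_bool (i = j) - of_bool (exploit h = i) :: real"
  let ?F = "\<lambda>h. if j \<in> fst ` set (drop t h) then 0 else ?\<phi> (take t h)"
  have alg': "is_algorithm S ?\<pi>"
    by (rule is_algorithm_explore[OF alg j ex])
  have "expect ?\<pi> v (t + n) (\<lambda>h. pmf (?\<pi> h) i) =
      expect ?\<pi> v (t + n) (\<lambda>h. of_bool (exploit (take t h) = i) + 1 / real (L - n) * ?F h)"
    by (rule expect_cong) (use n in \<open>simp add: pmf_explore length_histories\<close>)
  also have "\<dots> = expect ?\<pi> v t (\<lambda>h. of_bool (exploit h = i)) +
      1 / real (L - n) * ((1 - real n / real L) * expect \<pi> v t ?\<phi>)"
    unfolding expect_add expect_cmult
    using expect_take[OF alg' v, of t n "\<lambda>h. of_bool (exploit h = i)"] n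
    by (subst expect_unexplored[OF alg j ex v]) auto
  also have "expect ?\<pi> v t (\<lambda>h. of_bool (exploit h = i)) = expect \<pi> v t (\<lambda>h. of_bool (exploit h = i))"
    by (rule expect_policy_cong) (rule explore_cong)
  also have "1 / real (L - n) * ((1 - real n / real L) * expect \<pi> v t ?\<phi>) = expect \<pi> v t ?\<phi> / real L"
    using n by (simp add: field_simps of_nat_diff)
  also have "expect \<pi> v t ?\<phi> = of_bool (i = j) * v [] - expect \<pi> v t (\<lambda>h. of_bool (exploit h = i))"
    using expect_cmult[of \<pi> v t "of_bool (i = j)" "\<lambda>_. 1"] expect_1[OF alg v, of t]
    by (simp add: expect_diff)
  finally show ?thesis
    by (simp add: algebra_simps add_divide_distrib diff_divide_distrib)
qed

lemma explore_reachable: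
  assumes "policy_weight (explore j exploit t L \<pi>) h \<noteq> 0" "length h = t + L" "0 < L"
  shows "policy_weight \<pi> (take t h) \<noteq> 0"
    and "fst ` set (drop t h) \<subseteq> {j, exploit (take t h)}"
    and "j \<in> fst ` set (drop t h)"
proof -
  let ?\<pi> = "explore j exploit t L \<pi>"
  have "policy_weight \<pi> (take t h) = policy_weight ?\<pi> (take t h)"
    by (rule policy_weight_cong) (simp add: explore_cong)
  then show "policy_weight \<pi> (take t h) \<noteq> 0"
    using policy_weight_take_nonzero[OF assms(1)] by simp
  have nz: "pmf (?\<pi> (take (t + n) h)) (fst (h ! (t + n))) \<noteq> 0" if "n < L" for n
    using that assms(2) by (intro policy_weight_nth_nonzero[OF assms(1)]) simp
  have pm: "pmf (?\<pi> (take (t + n) h)) i = of_bool (exploit (take t h) = i) +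
    (if j \<in> fst ` set (drop t (take (t + n) h)) then 0
     else (of_bool (i = j) - of_bool (exploit (take t h) = i)) / real (L - n))" if "n < L" for n i
    using that assms(2) by (subst pmf_explore) (auto simp: min_def)
  have mem: "fst (drop t h ! n) \<in> {j, exploit (take t h)}" if "n < L" for n
    using nz[OF that] pm[OF that] assms(2) that by (auto split: if_splits)
  show "fst ` set (drop t h) \<subseteq> {j, exploit (take t h)}"
  proof
    fix a assume "a \<in> fst ` set (drop t h)"
    then obtain n where "n < length (drop t h)" "a = fst (drop t h ! n)"
      by (auto simp: in_set_conv_nth simp del: nth_drop)
    then show "a \<in> {j, exploit (take t h)}"
      using mem[of n] assms(2) by simp
  qed
  show "j \<in> fst ` set (drop t h)"
  \<comment> \<open>In the last round of the block the hazard rate is 1, so a history that has not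
    yet explored must choose \<open>j\<close> there.\<close>
  proof (cases "j \<in> fst ` set (drop t (take (t + (L - 1)) h))")
    case True
    then show ?thesis
      using set_take_subset by (fastforce simp: drop_take)
  next
    case False
    then have "fst (h ! (t + (L - 1))) = j"
      using nz[of "L - 1"] pm[of "L - 1"] assms(3) by (auto split: if_splits)
    moreover have "h ! (t + (L - 1)) \<in> set (drop t h)"
      using assms(2,3) nth_mem[of "L - 1" "drop t h"] by simp
    ultimately show ?thesis
      by force
  qed
qed

text \<open>One block of \<open>L\<close> rounds yields at least one sample of \<open>j\<close>, so
  \<open>s\<close> blocks yield \<open>s\<close> samples. For \<open>i \<noteq> j\<close> the gap is
  a multiple of the exploitation gap; for \<open>i = j\<close> it is the quantity in
  \<open>slack\<close>.\<close>

lemma explore_repeatedly: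
  assumes alg: "is_algorithm S \<pi>" and j: "j \<in> S" and ex: "\<And>h. exploit h \<in> S" and L: "0 < L"
    and before: "\<And>t i k. t < T \<Longrightarrow> i \<in> S \<Longrightarrow> k \<in> S \<Longrightarrow> 0 \<le> gap_rec A P \<pi> t i k"
    and exploit: "\<And>i k. i \<in> S \<Longrightarrow> k \<in> S \<Longrightarrow>
      0 \<le> expect \<pi> (\<lambda>h. V i h - V k h) T (\<lambda>h. of_bool (exploit h = i))"
    and slack: "\<And>k. k \<in> S \<Longrightarrow>
      0 \<le> (1 - 1 / real L) * expect \<pi> (\<lambda>h. V j h - V k h) T (\<lambda>h. of_bool (exploit h = j)) +
        (m j - m k) / real L"
  shows "\<exists>\<pi>'. is_algorithm S \<pi>' \<and> (\<forall>h. length h < T \<longrightarrow> \<pi>' h = \<pi> h) \<and>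
    (\<forall>t<T + s * L. \<forall>i\<in>S. \<forall>k\<in>S. 0 \<le> gap_rec A P \<pi>' t i k) \<and>
    (\<forall>h. length h = T + s * L \<and> policy_weight \<pi>' h \<noteq> 0 \<longrightarrow>
      fst ` set (drop T h) \<subseteq> {j, exploit (take T h)} \<and> s \<le> count_list (map fst (drop T h)) j)"
proof (induction s)
  case 0
  show ?case
    using alg before by (intro exI[of _ \<pi>]) auto
next
  case (Suc s)
  then obtain \<rho> where alg_\<rho>: "is_algorithm S \<rho>"
    and eq_\<rho>: "\<And>h. length h < T \<Longrightarrow> \<rho> h = \<pi> h"
    and gap_\<rho>: "\<And>t i k. t < T + s * L \<Longrightarrow> i \<in> S \<Longrightarrow> k \<in> S \<Longrightarrow> 0 \<le> gap_rec A P \<rho> t i k"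
    and reach_\<rho>: "\<And>h. length h = T + s * L \<Longrightarrow> policy_weight \<rho> h \<noteq> 0 \<Longrightarrow>
      fst ` set (drop T h) \<subseteq> {j, exploit (take T h)} \<and> s \<le> count_list (map fst (drop T h)) j"
    by metis
  define t where "t = T + s * L"
  \<comment> \<open>Every block exploits the arm fixed by the first \<open>T\<close> rounds and
    ignores what the earlier blocks revealed, so a single choice of \<open>L\<close> serves all
    blocks.\<close>
  define \<sigma> where "\<sigma> = explore j (\<lambda>h. exploit (take T h)) t L \<rho>"
  have alg_\<sigma>: "is_algorithm S \<sigma>"
    unfolding \<sigma>_def by (rule is_algorithm_explore[OF alg_\<rho> j ex])
  have eq_\<sigma>: "\<sigma> h = \<rho> h" if "length h < t" for h
    using that by (simp add: \<sigma>_def explore_cong)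
  \<comment> \<open>By the tower property the law of the exploited arm at the start of a later block
    is the one at time \<open>T\<close>, to which \<open>exploit\<close> and \<open>slack\<close>
    refer.\<close>
  have law: "expect \<rho> v t (\<lambda>h. of_bool (exploit (take T h) = i)) =
      expect \<pi> v T (\<lambda>h. of_bool (exploit h = i))" if "harmonic v" for v i
  proof -
    have "expect \<rho> v t (\<lambda>h. of_bool (exploit (take T h) = i)) =
        expect \<rho> v T (\<lambda>h. of_bool (exploit h = i))"
      unfolding t_def by (rule expect_take[OF alg_\<rho> that])
    also have "\<dots> = expect \<pi> v T (\<lambda>h. of_bool (exploit h = i))"
      by (rule expect_policy_cong) (rule eq_\<rho>)
    finally show ?thesis .
  qed
  have gap_\<sigma>: "0 \<le> gap_rec A P \<sigma> r i k" if r: "r < T + Suc s * L" and i: "i \<in> S" and k: "k \<in> S" for r i k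
  proof (cases "r < t")
    case True
    have "gap_rec A P \<sigma> r i k = gap_rec A P \<rho> r i k"
      unfolding gap_rec_eq_expect[OF alg_\<sigma> i k] gap_rec_eq_expect[OF alg_\<rho> i k]
      using True eq_\<sigma> expect_policy_cong[of r \<sigma> \<rho>]
      by (auto intro!: expect_cong simp: length_histories)
    then show ?thesis
      using gap_\<rho>[of r i k] True i k by (simp add: t_def)
  next
    case False
    define n where "n = r - t"
    have n: "r = t + n" "n < L"
      using False r by (auto simp: n_def t_def)
    have v: "harmonic (\<lambda>h. V i h - V k h)"
      by (rule harmonic_V_diff[OF i k])
    have "gap_rec A P \<sigma> r i k =
        (1 - 1 / real L) * expect \<pi> (\<lambda>h. V i h - V k h) T (\<lambda>h. of_bool (exploit h = i)) +
        of_bool (i = j) * (m i - m k) / real L"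
      unfolding gap_rec_eq_expect[OF alg_\<sigma> i k] n(1)
      using expect_explore[OF alg_\<rho> j ex v n(2), of "\<lambda>h. take T h" t i] law[OF v, of i]
        i[THEN subsetD[OF S_subset]] k[THEN subsetD[OF S_subset]]
      by (simp add: \<sigma>_def V_Nil)
    moreover have "0 \<le> (1 - 1 / real L) * expect \<pi> (\<lambda>h. V i h - V k h) T (\<lambda>h. of_bool (exploit h = i))"
      using exploit[OF i k] L by (intro mult_nonneg_nonneg) auto
    ultimately show ?thesis
      using slack[OF k] by (cases "i = j") auto
  qed
  have reach_\<sigma>: "fst ` set (drop T h) \<subseteq> {j, exploit (take T h)} \<and> Suc s \<le> count_list (map fst (drop T h)) j"
    if h: "length h = T + Suc s * L" "policy_weight \<sigma> h \<noteq> 0" for h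
  proof -
    have len: "length h = t + L"
      using h(1) by (simp add: t_def)
    note R = explore_reachable[OF h(2)[unfolded \<sigma>_def] len L]
    have "length (take t h) = T + s * L"
      using len by (simp add: t_def)
    note old = reach_\<rho>[OF this R(1)]
    have "drop T h = drop T (take t h) @ drop t h"
      using append_take_drop_id[of t h] len by (metis t_def drop_append diff_is_0_eq' drop0 le_add1
          length_take min.absorb2 le_add1)
    moreover have "0 < count_list (map fst (drop t h)) j"
      using R(3) by (simp add: count_list_0_iff flip: neq0_conv)
    ultimately show ?thesis
      using old R(2) by (auto simp: t_def min_def)
  qed
  show ?case
    using alg_\<sigma> gap_\<sigma> reach_\<sigma> eq_\<sigma> eq_\<rho> by (intro exI[of _ \<sigma>]) (auto simp: t_def)
qed

text \<open>The invariant of the exploration phase. That no arm outside \<open>E\<close> is ever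
  sampled matters as much as the sample counts: it keeps the posterior means of those arms at their
  prior means.\<close>

definition explored :: "nat \<Rightarrow> nat set \<Rightarrow> policy \<Rightarrow> nat \<Rightarrow> bool" where
  "explored N E \<pi> T \<longleftrightarrow> is_algorithm S \<pi> \<and>
    (\<forall>t<T. \<forall>i\<in>S. \<forall>k\<in>S. 0 \<le> gap_rec A P \<pi> t i k) \<and>
    (\<forall>h. length h = T \<and> policy_weight \<pi> h \<noteq> 0 \<longrightarrow>
      fst ` set h \<subseteq> E \<and> (\<forall>k\<in>E. N \<le> count_list (map fst h) k))"

section \<open>All-zero histories and the required sample size\<close>

lemma ex_zero_history:
  "\<exists>h. length h = n \<and> policy_weight \<pi> h \<noteq> 0 \<and> (\<forall>y\<in>set h. \<not> snd y)"
proof (induction n)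
  case (Suc n)
  then obtain h where "length h = n" "policy_weight \<pi> h \<noteq> 0" "\<forall>y\<in>set h. \<not> snd y"
    by blast
  moreover obtain a where "a \<in> set_pmf (\<pi> h)"
    using set_pmf_not_empty[of "\<pi> h"] by blast
  ultimately show ?case
    \<comment> \<open>Policy weights do not involve reward probabilities, so reward zero may be
      appended to any possible recommendation.\<close>
    by (intro exI[of _ "h @ [(a, False)]"]) (auto simp: set_pmf_iff)
qed simp

lemma moment_zeros:
  assumes "a \<in> A" "\<forall>y\<in>set h. \<not> snd y"
  shows "moment P h a = (\<integral>x. (1 - x) ^ count_list (map fst h) a \<partial>P a)"
    and "first_moment P h a = (\<integral>x. x * (1 - x) ^ count_list (map fst h) a \<partial>P a)"
proof -
  have "AE x in P a. arm_likelihood h a x = (1 - x) ^ count_list (map fst h) a"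
    using AE_arm[OF assms(1)] by eventually_elim (simp add: arm_likelihood_zeros[OF assms(2)])
  then show "moment P h a = (\<integral>x. (1 - x) ^ count_list (map fst h) a \<partial>P a)"
    and "first_moment P h a = (\<integral>x. x * (1 - x) ^ count_list (map fst h) a \<partial>P a)"
    unfolding moment_def first_moment_def
    by (auto intro!: integral_cong_AE measurable_arm[OF assms(1)] elim!: eventually_mono)
qed

text \<open>Zero rewards are impossible only at mean 1, and a mean almost surely equal to 1 is
  excluded as degenerate.\<close>

lemma moment_zeros_pos:
  assumes a: "a \<in> A" and h: "\<forall>y\<in>set h. \<not> snd y"
  shows "0 < moment P h a"
proof (rule ccontr)
  assume "\<not> ?thesis"
  then have "(\<integral>x. arm_likelihood h a x \<partial>P a) = 0"
    using moment_nonneg[of h a] by (simp add: moment_def)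
  then have "AE x in P a. arm_likelihood h a x = 0"
    using integrable_likelihood[OF a]
    by (subst (asm) integral_nonneg_eq_0_iff_AE) (auto simp: arm_likelihood_nonneg)
  with AE_arm[OF a] have "AE x in P a. x = 0 \<or> x = 1"
    by eventually_elim (use arm_likelihood_zeros[OF h] in auto)
  then show False
    using not_AE_two_point[OF a, of 0] by simp
qed

text \<open>There are finitely many pairs, so one threshold works for all of them.
  \<open>N \<ge> 1\<close> ensures that an arm with \<open>N\<close> samples has been chosen at
  all.\<close>

lemma ex_sample_size:
  "\<exists>N\<ge>1. \<forall>n\<ge>N. \<forall>j\<in>S. \<forall>k\<in>S. j \<noteq> k \<longrightarrow>
    (\<integral>x. x * (1 - x) ^ n \<partial>P k) < m j * (\<integral>x. (1 - x) ^ n \<partial>P k)"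
proof -
  have "\<forall>\<^sub>F n in sequentially. j \<noteq> k \<longrightarrow>
      (\<integral>x. x * (1 - x) ^ n \<partial>P k) < m j * (\<integral>x. (1 - x) ^ n \<partial>P k)" if "j \<in> S" "k \<in> S" for j k
  proof (cases "j = k")
    case False
    have A: "j \<in> A" "k \<in> A"
      using that S_subset by auto
    have "\<not> (AE x in P k. m j \<le> x)"
      using that False by (simp add: S_arms_def flip: not_dominated_iff)
    then show ?thesis
      using eventually_zeros_below[OF A(2) prior_mean_bounds[OF A(1)]] by simp
  qed simp
  then have "\<forall>\<^sub>F n in sequentially. \<forall>j\<in>S. \<forall>k\<in>S. j \<noteq> k \<longrightarrow>
      (\<integral>x. x * (1 - x) ^ n \<partial>P k) < m j * (\<integral>x. (1 - x) ^ n \<partial>P k)"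
    by (intro eventually_ball_finite finite_S ballI) auto
  then obtain N where "\<forall>n\<ge>N. \<forall>j\<in>S. \<forall>k\<in>S. j \<noteq> k \<longrightarrow>
      (\<integral>x. x * (1 - x) ^ n \<partial>P k) < m j * (\<integral>x. (1 - x) ^ n \<partial>P k)"
    unfolding eventually_sequentially by blast
  then show ?thesis
    by (intro exI[of _ "max N 1"]) auto
qed

section \<open>Greedy enlargement of the explored set\<close>

lemma ex_exploit:
  assumes "finite B" "B \<noteq> {}"
  shows "\<exists>exploit. \<forall>h. exploit h \<in> B \<and> (\<forall>k\<in>B. V k h \<le> V (exploit h) h)"
proof -
  have "\<exists>i\<in>B. \<forall>k\<in>B. V k h \<le> V i h" for h
  proof -
    have "Max ((\<lambda>k. V k h) ` B) \<in> (\<lambda>k. V k h) ` B"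
      using assms by simp
    then obtain i where "i \<in> B" "V i h = Max ((\<lambda>k. V k h) ` B)"
      by auto
    moreover have "V k h \<le> Max ((\<lambda>k. V k h) ` B)" if "k \<in> B" for k
      using that assms by simp
    ultimately show ?thesis
      by metis
  qed
  then show ?thesis
    by metis
qed

text \<open>Exploitation at time \<open>T\<close> has nonnegative gaps throughout and a positive
  gain for \<open>j\<close> over explored arms on an all-zero history. A large block length
  \<open>L\<close> lets this gain pay for exploring \<open>j\<close> with weight
  \<open>1 / L\<close>.\<close>

lemma explored_insert:
  assumes N: "\<And>n j k. N \<le> n \<Longrightarrow> j \<in> S \<Longrightarrow> k \<in> S \<Longrightarrow> j \<noteq> k \<Longrightarrow>
      (\<integral>x. x * (1 - x) ^ n \<partial>P k) < m j * (\<integral>x. (1 - x) ^ n \<partial>P k)"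
    and good: "explored N E \<pi> T" and E: "E \<subseteq> S"
    and j: "j \<in> S - E" and max: "\<And>k. k \<in> S - E \<Longrightarrow> m k \<le> m j"
  shows "\<exists>\<pi>' T'. explored N (insert j E) \<pi>' T'"
proof -
  have alg: "is_algorithm S \<pi>"
    and before: "\<And>t i k. t < T \<Longrightarrow> i \<in> S \<Longrightarrow> k \<in> S \<Longrightarrow> 0 \<le> gap_rec A P \<pi> t i k"
    and reach: "\<And>h. length h = T \<Longrightarrow> policy_weight \<pi> h \<noteq> 0 \<Longrightarrow>
      fst ` set h \<subseteq> E \<and> (\<forall>k\<in>E. N \<le> count_list (map fst h) k)"
    using good by (auto simp: explored_def)
  have jS: "j \<in> S" and jE: "j \<notin> E" and finE: "finite E"
    using j E finite_S finite_subset by auto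
  have SA: "k \<in> A" if "k \<in> S" for k
    using that S_subset by auto
  \<comment> \<open>Maximising over \<open>insert j E\<close> keeps all other arms unsampled, yet is
    optimal over \<open>S\<close> on reachable histories, since \<open>j\<close> has the greatest
    prior mean among the unexplored arms.\<close>
  obtain exploit where ex: "\<And>h. exploit h \<in> insert j E"
    and ex_max: "\<And>h k. k \<in> insert j E \<Longrightarrow> V k h \<le> V (exploit h) h"
    using ex_exploit[of "insert j E"] finE by auto
  have ex_S: "exploit h \<in> S" for h
    using ex[of h] E jS by auto
  have new: "V k h = m k * W h" if "k \<in> S - E" "length h = T" "policy_weight \<pi> h \<noteq> 0" for k h
    using that reach[of h] SA by (intro V_unsampled) auto
  have unexplored: "V k h \<le> V j h" if "k \<in> S - E" "length h = T" "policy_weight \<pi> h \<noteq> 0" for k h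
    using new[OF that] new[OF j that(2,3)] max[OF that(1)] W_nonneg[of h] by (simp add: mult_right_mono)
  have best: "V k h \<le> V (exploit h) h" if "k \<in> S" "length h = T" "policy_weight \<pi> h \<noteq> 0" for k h
    using ex_max[of k h] ex_max[of j h] unexplored[of k h] that by fastforce
  have summand_nonneg: "0 \<le> policy_weight \<pi> h * (V i h - V k h) * of_bool (exploit h = i)"
    if "k \<in> S" "h \<in> histories S T" for i k h
  proof (cases "policy_weight \<pi> h = 0 \<or> exploit h \<noteq> i")
    case False
    then show ?thesis
      using best[of k h] that by (auto simp: length_histories policy_weight_nonneg)
  qed auto
  have exploit_nonneg: "0 \<le> expect \<pi> (\<lambda>h. V i h - V k h) T (\<lambda>h. of_bool (exploit h = i))"
    if "k \<in> S" for i k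
    unfolding expect_def by (intro sum_nonneg summand_nonneg that)
  \<comment> \<open>On this single reachable history every explored arm has at least
    \<open>N\<close> zero rewards and looks strictly worse than \<open>j\<close>; its contribution
    \<open>c k\<close> bounds the gain from below.\<close>
  obtain z where z: "length z = T" "policy_weight \<pi> z \<noteq> 0" "\<forall>y\<in>set z. \<not> snd y"
    using ex_zero_history by blast
  define c where "c k = policy_weight \<pi> z * (V j z - V k z)" for k
  have V_less: "V k z < V j z" if k: "k \<in> E" for k
  proof -
    have kS: "k \<in> S" and kj: "j \<noteq> k"
      using k E jE by auto
    have "N \<le> count_list (map fst z) k"
      using reach[OF z(1,2)] k by blast
    then have "first_moment P z k < m j * moment P z k"
      unfolding moment_zeros[OF SA[OF kS] z(3)] using N jS kS kj by blast
    moreover have "0 < (\<Prod>a\<in>A - {k}. moment P z a)"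
      using moment_zeros_pos[OF _ z(3)] by (intro prod_pos) auto
    ultimately have "V k z < m j * W z"
      by (simp add: weighted_mean_def W_remove[OF SA[OF kS]] flip: mult.assoc)
    then show ?thesis
      using new[OF j z(1,2)] by simp
  qed
  have c_pos: "0 < c k" if "k \<in> E" for k
    using V_less[OF that] z(2) policy_weight_nonneg[of \<pi> z] by (simp add: c_def order_less_le)
  have "exploit z = j"
    using ex[of z] ex_max[of j z] V_less[of "exploit z"] by fastforce
  have gain: "c k \<le> expect \<pi> (\<lambda>h. V j h - V k h) T (\<lambda>h. of_bool (exploit h = j))" if "k \<in> S" for k
  proof -
    have zh: "z \<in> histories S T"
      using policy_weight_nonzero_arms[OF alg z(2)] z(1) by simp
    have "policy_weight \<pi> z * (V j z - V k z) * of_bool (exploit z = j) \<le>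
        expect \<pi> (\<lambda>h. V j h - V k h) T (\<lambda>h. of_bool (exploit h = j))"
      unfolding expect_def
      by (rule member_le_sum[OF zh]) (use summand_nonneg[OF that] finite_histories[OF finite_S] in auto)
    then show ?thesis
      using \<open>exploit z = j\<close> by (simp add: c_def)
  qed
  \<comment> \<open>The sum dominates each \<open>1 / c k\<close>, so
    \<open>L0 * c k \<ge> 1\<close> for every explored \<open>k\<close>; an empty \<open>E\<close>
    causes no special case.\<close>
  obtain L0 where L0: "(\<Sum>k\<in>E. 1 / c k) \<le> real L0"
    using real_arch_simple by blast
  define L where "L = Suc L0"
  have L: "0 < L"
    by (simp add: L_def)
  \<comment> \<open>For explored \<open>k\<close>, the gain times \<open>L - 1\<close> is at least 1
    and outweighs \<open>m k - m j\<close>, which is at most 1. For unexplored \<open>k\<close>,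
    both summands are nonnegative by the choice of \<open>j\<close>.\<close>
  have slack: "0 \<le> (1 - 1 / real L) * expect \<pi> (\<lambda>h. V j h - V k h) T (\<lambda>h. of_bool (exploit h = j)) +
      (m j - m k) / real L" if k: "k \<in> S" for k
  proof (cases "k \<in> E")
    case True
    have "1 / c k \<le> (\<Sum>k\<in>E. 1 / c k)"
      using c_pos finE True by (intro member_le_sum) (auto intro: less_imp_le)
    with L0 have "1 / c k \<le> real L0"
      by linarith
    then have "1 \<le> real L0 * c k"
      by (simp only: pos_divide_le_eq[OF c_pos[OF True]])
    also have "\<dots> \<le> real L0 * expect \<pi> (\<lambda>h. V j h - V k h) T (\<lambda>h. of_bool (exploit h = j))"
      using gain[OF k] by (intro mult_left_mono) auto
    finally have "0 \<le> real L0 * expect \<pi> (\<lambda>h. V j h - V k h) T (\<lambda>h. of_bool (exploit h = j)) + (m j - m k)"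
      using prior_mean_bounds[OF SA[OF jS]] prior_mean_bounds[OF SA[OF k]] by simp
    then have "0 \<le> (real L0 * expect \<pi> (\<lambda>h. V j h - V k h) T (\<lambda>h. of_bool (exploit h = j)) + (m j - m k)) / real L"
      by simp
    also have "\<dots> = real L0 / real L * expect \<pi> (\<lambda>h. V j h - V k h) T (\<lambda>h. of_bool (exploit h = j)) +
        (m j - m k) / real L"
      by (simp add: add_divide_distrib)
    also have "real L0 / real L = 1 - 1 / real L"
      by (simp add: L_def field_simps)
    finally show ?thesis .
  next
    case False
    then have "m k \<le> m j"
      using max k by simp
    moreover have "0 \<le> (1 - 1 / real L) * expect \<pi> (\<lambda>h. V j h - V k h) T (\<lambda>h. of_bool (exploit h = j))"
      using exploit_nonneg[OF k, of j] by (intro mult_nonneg_nonneg) (auto simp: L_def)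
    ultimately show ?thesis
      by simp
  qed
  have "\<exists>\<pi>'. is_algorithm S \<pi>' \<and> (\<forall>h. length h < T \<longrightarrow> \<pi>' h = \<pi> h) \<and>
    (\<forall>t<T + N * L. \<forall>i\<in>S. \<forall>k\<in>S. 0 \<le> gap_rec A P \<pi>' t i k) \<and>
    (\<forall>h. length h = T + N * L \<and> policy_weight \<pi>' h \<noteq> 0 \<longrightarrow>
      fst ` set (drop T h) \<subseteq> {j, exploit (take T h)} \<and> N \<le> count_list (map fst (drop T h)) j)"
    by (rule explore_repeatedly[OF alg jS ex_S L]) (assumption | rule before exploit_nonneg slack)+
  then obtain \<pi>' where alg': "is_algorithm S \<pi>'" and eq': "\<And>h. length h < T \<Longrightarrow> \<pi>' h = \<pi> h"
    and gap': "\<And>t i k. t < T + N * L \<Longrightarrow> i \<in> S \<Longrightarrow> k \<in> S \<Longrightarrow> 0 \<le> gap_rec A P \<pi>' t i k"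
    and reach': "\<And>h. length h = T + N * L \<Longrightarrow> policy_weight \<pi>' h \<noteq> 0 \<Longrightarrow>
      fst ` set (drop T h) \<subseteq> {j, exploit (take T h)} \<and> N \<le> count_list (map fst (drop T h)) j"
    by (elim exE conjE) simp
  have "fst ` set h \<subseteq> insert j E \<and> (\<forall>k\<in>insert j E. N \<le> count_list (map fst h) k)"
    if h: "length h = T + N * L" "policy_weight \<pi>' h \<noteq> 0" for h
  proof -
    have "policy_weight \<pi> (take T h) = policy_weight \<pi>' (take T h)"
      by (rule policy_weight_cong) (simp add: eq')
    then have old: "fst ` set (take T h) \<subseteq> E \<and> (\<forall>k\<in>E. N \<le> count_list (map fst (take T h)) k)"
      using h policy_weight_take_nonzero[OF h(2), of T] by (intro reach) auto
    have "set h = set (take T h) \<union> set (drop T h)"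
      by (metis append_take_drop_id set_append)
    moreover have "count_list (map fst h) k =
        count_list (map fst (take T h)) k + count_list (map fst (drop T h)) k" for k
      by (metis append_take_drop_id count_list_append map_append)
    moreover have "fst ` set (drop T h) \<subseteq> insert j E" "N \<le> count_list (map fst (drop T h)) j"
      using reach'[OF h] ex[of "take T h"] by auto
    ultimately show ?thesis
      using old by (auto simp: image_Un intro: trans_le_add1)
  qed
  then have "explored N (insert j E) \<pi>' (T + N * L)"
    using alg' gap' by (simp add: explored_def)
  then show ?thesis
    by blast
qed

lemma ex_explored:
  assumes N: "\<And>n j k. N \<le> n \<Longrightarrow> j \<in> S \<Longrightarrow> k \<in> S \<Longrightarrow> j \<noteq> k \<Longrightarrow>
      (\<integral>x. x * (1 - x) ^ n \<partial>P k) < m j * (\<integral>x. (1 - x) ^ n \<partial>P k)"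
    and "n \<le> card S"
  shows "\<exists>E \<pi> T. E \<subseteq> S \<and> card E = n \<and> explored N E \<pi> T"
  using assms(2)
proof (induction n)
  case 0
  obtain j where "j \<in> S"
    using S_nonempty by blast
  then have "explored N {} (\<lambda>_. return_pmf j) 0"
    by (simp add: explored_def is_algorithm_def)
  then show ?case
    by (intro exI[of _ "{}"]) auto
next
  case (Suc n)
  then obtain E \<pi> T where E: "E \<subseteq> S" "card E = n" and good: "explored N E \<pi> T"
    by auto
  have "S - E \<noteq> {}"
    using E Suc.prems by (metis Diff_eq_empty_iff card_mono finite_S finite_subset not_less_eq_eq)
  then have "Max (m ` (S - E)) \<in> m ` (S - E)"
    using finite_S by simp
  \<comment> \<open>Taking the unexplored arm of greatest prior mean provides the maximality that
    \<open>explored_insert\<close> requires.\<close>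
  then obtain j where j: "j \<in> S - E" "m j = Max (m ` (S - E))"
    by auto
  then have "m k \<le> m j" if "k \<in> S - E" for k
    using that finite_S by simp
  then obtain \<pi>' T' where "explored N (insert j E) \<pi>' T'"
    using explored_insert[OF N good E(1) j(1)] by blast
  moreover have "card (insert j E) = Suc n" "insert j E \<subseteq> S"
    using E j(1) finite_subset[OF E(1) finite_S] by auto
  ultimately show ?case
    by blast
qed

lemma ex_exploring_BIC_algorithm:
  "\<exists>\<pi> T. is_algorithm A \<pi> \<and> BIC A P \<pi> \<and> (\<forall>i\<in>S. prob_chosen_within A P \<pi> T i = 1)"
proof -
  obtain N where N: "1 \<le> N" "\<And>n j k. N \<le> n \<Longrightarrow> j \<in> S \<Longrightarrow> k \<in> S \<Longrightarrow> j \<noteq> k \<Longrightarrow>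
      (\<integral>x. x * (1 - x) ^ n \<partial>P k) < m j * (\<integral>x. (1 - x) ^ n \<partial>P k)"
    using ex_sample_size by blast
  have "\<exists>E \<pi> T. E \<subseteq> S \<and> card E = card S \<and> explored N E \<pi> T"
    by (rule ex_explored[OF N(2)]) simp_all
  then obtain E \<pi> T where "E \<subseteq> S" "card E = card S" and "explored N E \<pi> T"
    by blast
  then have good: "explored N S \<pi> T"
    using card_subset_eq[OF finite_S] by metis
  then have alg: "is_algorithm S \<pi>"
    and before: "\<And>t i k. t < T \<Longrightarrow> i \<in> S \<Longrightarrow> k \<in> S \<Longrightarrow> 0 \<le> gap_rec A P \<pi> t i k"
    by (auto simp: explored_def)
  obtain exploit where ex: "\<And>h. exploit h \<in> S"
    and ex_max: "\<And>h k. k \<in> S \<Longrightarrow> V k h \<le> V (exploit h) h"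
    using ex_exploit[OF finite_S S_nonempty] by auto
  \<comment> \<open>After round \<open>T\<close> the arm that is posterior-optimal at time
    \<open>T\<close> is repeated forever. By the tower property each later gap equals the gap at
    time \<open>T\<close>, which is nonnegative by optimality.\<close>
  define \<sigma> where "\<sigma> h = (if length h < T then \<pi> h else return_pmf (exploit (take T h)))" for h
  have alg_\<sigma>: "is_algorithm S \<sigma>"
    using alg ex by (auto simp: \<sigma>_def is_algorithm_def)
  have eq_\<sigma>: "\<sigma> h = \<pi> h" if "length h < T" for h
    using that by (simp add: \<sigma>_def)
  have "0 \<le> gap_rec A P \<sigma> t i k" if i: "i \<in> S" and k: "k \<in> S" for t i k
  proof (cases "t < T")
    case True
    have "gap_rec A P \<sigma> t i k = gap_rec A P \<pi> t i k"
      unfolding gap_rec_eq_expect[OF alg_\<sigma> i k] gap_rec_eq_expect[OF alg i k]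
      using True eq_\<sigma> expect_policy_cong[of t \<sigma> \<pi>]
      by (auto intro!: expect_cong simp: length_histories)
    then show ?thesis
      using before True i k by simp
  next
    case False
    then obtain n where n: "t = T + n"
      using le_Suc_ex by (metis not_less)
    have "gap_rec A P \<sigma> t i k = expect \<sigma> (\<lambda>h. V i h - V k h) (T + n) (\<lambda>h. of_bool (exploit (take T h) = i))"
      unfolding gap_rec_eq_expect[OF alg_\<sigma> i k] n
      by (rule expect_cong) (simp add: \<sigma>_def length_histories)
    also have "\<dots> = expect \<sigma> (\<lambda>h. V i h - V k h) T (\<lambda>h. of_bool (exploit h = i))"
      by (rule expect_take[OF alg_\<sigma> harmonic_V_diff[OF i k]])
    also have "0 \<le> \<dots>"
      unfolding expect_def
      using ex_max[OF k] by (intro sum_nonneg) (auto simp: of_bool_def policy_weight_nonneg)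
    finally show ?thesis .
  qed
  then have BIC: "BIC A P \<sigma>"
    by (intro BIC_if_BIC_on_S alg_\<sigma>)
  have "prob_chosen_within A P \<sigma> T i = 1" if i: "i \<in> S" for i
  proof -
    \<comment> \<open>The guarantee in \<open>explored\<close> rests on policy weights alone, so it
      holds under every mean vector.\<close>
    have "i \<in> fst ` set h" if h: "h \<in> set_pmf (hist \<sigma> \<mu> T)" for \<mu> h
    proof -
      have "policy_weight \<pi> h = policy_weight \<sigma> h"
        using set_hist[OF h] by (intro policy_weight_cong) (simp add: eq_\<sigma>)
      then have "N \<le> count_list (map fst h) i"
        using good set_hist[OF h] i by (auto simp: explored_def)
      then have "i \<in> set (map fst h)"
        using N(1) by (metis count_list_0_iff not_one_le_zero le_zero_eq)
      then show ?thesis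
        by simp
    qed
    then have "measure_pmf.prob (hist \<sigma> \<mu> T) {h. i \<in> fst ` set h} = 1" for \<mu>
      by (subst measure_pmf.prob_eq_1) (auto simp: AE_measure_pmf_iff)
    moreover have "prob_space (prior A P)"
      unfolding prior_def by (intro prob_space_PiM prob_space_arm)
    ultimately show ?thesis
      by (simp add: prob_chosen_within_def prob_space.prob_space)
  qed
  with BIC show ?thesis
    using is_algorithm_mono[OF alg_\<sigma> S_subset] by blast
qed

end

theorem theoremA1:
  fixes A :: "nat set" and P :: "nat \<Rightarrow> real measure"
  assumes inst: "valid_instance A P"
    and nondeg: "\<forall>i\<in>A. \<not> support_degenerate P i"
  shows
    "(\<forall>\<pi> t i. is_algorithm A \<pi> \<and> BIC A P \<pi> \<and> prob_rec A P \<pi> t i > 0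
        \<longrightarrow> i \<in> S_arms A P)
     \<and> (\<forall>alg :: nat set \<Rightarrow> (nat \<Rightarrow> real measure) \<Rightarrow> policy.
          (\<forall>A' P'. valid_instance A' P' \<and> pairwise_nondominance A' P'
              \<longrightarrow> is_algorithm A' (alg A' P') \<and> BIC A' P' (alg A' P'))
          \<longrightarrow> is_algorithm A (alg (S_arms A P) (restrict P (S_arms A P)))
            \<and> BIC A P (alg (S_arms A P) (restrict P (S_arms A P))))
     \<and> (\<exists>\<pi> tstar. is_algorithm A \<pi> \<and> BIC A P \<pi> \<and>
          (\<forall>i\<in>S_arms A P. prob_chosen_within A P \<pi> tstar i = 1))"
proof -
  interpret nondegenerate_bandit A P
    by standard (rule inst, rule nondeg)
  have "is_algorithm A (alg S (restrict P S)) \<and> BIC A P (alg S (restrict P S))"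
    if "\<forall>A' P'. valid_instance A' P' \<and> pairwise_nondominance A' P'
      \<longrightarrow> is_algorithm A' (alg A' P') \<and> BIC A' P' (alg A' P')"
    for alg :: "nat set \<Rightarrow> (nat \<Rightarrow> real measure) \<Rightarrow> policy"
  proof -
    \<comment> \<open>The restricted instance is valid and satisfies pairwise non-dominance, so the
      assumption on \<open>alg\<close> applies to it.\<close>
    have "is_algorithm S (alg S (restrict P S))" "BIC S (restrict P S) (alg S (restrict P S))"
      using that valid_restrict[OF S_subset S_nonempty] pairwise_nondominance_S by blast+
    then show ?thesis
      using is_algorithm_mono[OF _ S_subset] BIC_restrict_S by blast
  qed
  then show ?thesis
    using recommended_imp_S ex_exploring_BIC_algorithm by blast
qed

end
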